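(* Let $p\in\mathbb R[x]$ be a polynomial of degree $d\ge 1$ with $p(0)=0$, and let $(n_i)_{i=1}^\infty$ be a sequence of positive integers. Then for every $\varepsilon>0$ there exists a finite non-empty set $\alpha\subset\mathbb N$ with gaps bounded by $d$ (i.e. $\alpha\in\mathcal S_d$) such that $\big\|p\big(\sum_{i\in\alpha}n_i\big)\big\|_{\mathbb R/\mathbb Z}\le\varepsilon$.
   Context: $\mathbb N=\{1,2,\dots\}$. $\|x\|_{\mathbb R/\mathbb Z}$ denotes the distance from $x\in\mathbb R$ to the nearest integer. For a finite set $\alpha=\{i_1<i_2<\dots<i_r\}$ its gaps are $i_2-i_1,\dots,i_r-i_{r-1}$. For $k\ge0$, $\mathcal S_k$ denotes the family of finite non-empty $\alpha\subset\mathbb N$ such that for every $i\in\alpha$, either $i=\max\alpha$ or there is $j\in\alpha$ with $i<j\le i+k$. *)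

theory Defs
  imports "HOL-Analysis.Analysis" "HOL-Computational_Algebra.Polynomial"
begin

definition dist_to_int :: "real \<Rightarrow> real" where
  "dist_to_int x = \<bar>x - real_of_int (round x)\<bar>"

definition S_fam :: "nat \<Rightarrow> nat set set" where
  "S_fam k = {\<alpha>. finite \<alpha> \<and> \<alpha> \<noteq> {} \<and> \<alpha> \<subseteq> {1..} \<and>
     (\<forall>i\<in>\<alpha>. i = Max \<alpha> \<or> (\<exists>j\<in>\<alpha>. i < j \<and> j \<le> i + k))}"

end

(*
  Idea.  Words over {take, skip} act on circle-valued functions of words by shifting.  The
  function w |-> exp(2 pi i p(sum of the n_i taken by w)) vanishes on skip^N and is killed by
  d + 1 differences of words of equal length, d = deg p.  Pointwise limits of the actions form a
  compact semigroup, and Ellis' lemma yields simultaneous idempotent limits u of take^N and v of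
  skip^N.  Modulo operators killing the polynomial functions, the elements u z u with z a limit of
  words without d consecutive skips, and with z congruent to u, form a unipotent group H.

  Take a window of d - 1 positions and long stretches left and right of it, cut into residue
  classes mod d.  Skipping a set of these positions and classes is a polynomial map of degree at
  most d into the unipotent group, so up to its values on the two sides it is generated by its
  values on sets of at most d pieces that meet both stretches; such sets never contain d
  consecutive positions, so these values lie in H.  Skipping everything and skipping all but the
  right stretch both give u v u.  Hence the third corner, u take^N skip^(d-1) v u in the limit,
  lies in H too.  Inverting it in H turns v into a limit of words skip^N w skip^M with w
  admissible, and v evaluates p at 0.
*)
theory Submission
  imports Defs "HOL-Library.Function_Algebras"
begin

subsection \<open>Filtered rings\<close>

text \<open>Degree d makes d + 1 differences vanish, so only sets of at most d pieces contribute.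
  Such a set that meets both stretches keeps at most d - 1 pieces once those of one stretch are
  removed, too few to skip d positions in a row. The window has length d - 1 because it may then be
  skipped entirely, while d consecutive positions still cannot meet both stretches.

  The obstacle is that u v u comes from skipping a whole stretch and is not known to lie in H. It is
  never shown to: it occurs at two corners of the same product and cancels there. A second obstacle
  is one-sided continuity: multiplication of limits is only guaranteed to be continuous in the left
  factor, so inverses in H are not obtained as limits of inverses. They come from idempotents, since
  an idempotent e with u e = e u = e that agrees with u modulo the first filtration step agrees with
  it modulo every step.\<close>

locale filtered_ring =
  fixes I :: "nat \<Rightarrow> 'r::ring_1 set"
  assumes zero_mem [simp]: "0 \<in> I j"
    and add_mem: "x \<in> I j \<Longrightarrow> y \<in> I j \<Longrightarrow> x + y \<in> I j"
    and uminus_mem: "x \<in> I j \<Longrightarrow> - x \<in> I j"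
    and one_mem [simp]: "1 \<in> I 0"
    and mult_mem: "x \<in> I i \<Longrightarrow> y \<in> I j \<Longrightarrow> x * y \<in> I (i + j)"
    and Suc_subset: "I (Suc j) \<subseteq> I j"
begin

lemma diff_mem: "x \<in> I j \<Longrightarrow> y \<in> I j \<Longrightarrow> x - y \<in> I j"
  using add_mem[of x j "- y"] uminus_mem[of y j] by simp

lemma antimono_mem: "x \<in> I j \<Longrightarrow> i \<le> j \<Longrightarrow> x \<in> I i"
  using lift_Suc_antimono_le[of I, OF Suc_subset] by blast

lemma mult_mem_left: "x \<in> I 0 \<Longrightarrow> y \<in> I j \<Longrightarrow> x * y \<in> I j"
  using mult_mem[of x 0 y j] by simp

lemma mult_mem_right: "x \<in> I j \<Longrightarrow> y \<in> I 0 \<Longrightarrow> x * y \<in> I j"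
  using mult_mem[of x j y 0] by simp

lemma sum_mem: "(\<And>a. a \<in> A \<Longrightarrow> f a \<in> I j) \<Longrightarrow> sum f A \<in> I j"
  by (induction A rule: infinite_finite_induct) (auto intro: add_mem)

lemma power_mem: "x \<in> I 1 \<Longrightarrow> x ^ k \<in> I k"
proof (induction k)
  case (Suc k)
  then show ?case using mult_mem[of x 1 "x ^ k" k] by simp
qed simp

lemma cong_mult:
  assumes "a - b \<in> I j" "a' - b' \<in> I j" "a' \<in> I 0" "b \<in> I 0"
  shows "a * a' - b * b' \<in> I j"
proof -
  have "a * a' - b * b' = (a - b) * a' + b * (a' - b')"
    by (simp add: algebra_simps)
  then show ?thesis
    using assms by (simp add: add_mem mult_mem_left mult_mem_right)
qed

lemma cong_trans: "a - b \<in> I j \<Longrightarrow> b - c \<in> I j \<Longrightarrow> a - c \<in> I j"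
  using add_mem[of "a - b" j "b - c"] by simp

lemma cong_sym: "a - b \<in> I j \<Longrightarrow> b - a \<in> I j"
  using uminus_mem[of "a - b" j] by simp

subsection \<open>Polynomial maps on finite sets\<close>

text \<open>The \<open>E \<beta>\<close> are the iterated differences of x at the empty set in the
  directions of \<beta>, so the condition is polynomiality relative to the filtration. Asking for
  the existence of \<open>E\<close> keeps products direct and presents the class as a projection,
  which gives closedness under limits later. Infinite sets are left out because \<open>card\<close>
  and the sum would default to 0 on them.\<close>

definition cube_poly :: "('q set \<Rightarrow> 'r) \<Rightarrow> bool" where
  "cube_poly x \<longleftrightarrow> (\<exists>E. (\<forall>\<beta>. finite \<beta> \<longrightarrow> E \<beta> \<in> I (card \<beta>)) \<and>
     (\<forall>\<sigma>. finite \<sigma> \<longrightarrow> x \<sigma> = (\<Sum>\<beta>\<in>Pow \<sigma>. E \<beta>)))"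

lemma cube_polyI:
  assumes "\<And>\<beta>. finite \<beta> \<Longrightarrow> E \<beta> \<in> I (card \<beta>)"
    and "\<And>\<sigma>. finite \<sigma> \<Longrightarrow> x \<sigma> = (\<Sum>\<beta>\<in>Pow \<sigma>. E \<beta>)"
  shows "cube_poly x"
  unfolding cube_poly_def using assms by blast

lemma cube_poly_mem:
  assumes "cube_poly x" "finite \<sigma>"
  shows "x \<sigma> \<in> I 0"
  using assms unfolding cube_poly_def
  by (auto intro!: sum_mem) (meson antimono_mem finite_subset le0)

lemma cube_poly_diff_empty_mem:
  assumes "cube_poly x" "finite \<sigma>"
  shows "x \<sigma> - x {} \<in> I 1"
proof -
  obtain E where E: "\<And>\<beta>. finite \<beta> \<Longrightarrow> E \<beta> \<in> I (card \<beta>)"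
    and x: "\<And>\<sigma>. finite \<sigma> \<Longrightarrow> x \<sigma> = (\<Sum>\<beta>\<in>Pow \<sigma>. E \<beta>)"
    using assms(1) unfolding cube_poly_def by blast
  have "x \<sigma> - x {} = (\<Sum>\<beta>\<in>Pow \<sigma> - {{}}. E \<beta>)"
    using assms(2) by (simp add: x sum_diff1)
  also have "\<dots> \<in> I 1"
  proof (rule sum_mem)
    fix \<beta> assume \<beta>: "\<beta> \<in> Pow \<sigma> - {{}}"
    then have fin: "finite \<beta>" using assms(2) finite_subset by blast
    then have "1 \<le> card \<beta>" using \<beta> by (simp add: Suc_leI card_gt_0_iff)
    then show "E \<beta> \<in> I 1" using E[OF fin] antimono_mem by blast
  qed
  finally show ?thesis .
qed

lemma cube_poly_step:
  assumes "finite \<beta>" "c - 1 \<in> I (card \<beta>)"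
  shows "cube_poly (\<lambda>\<sigma>. if \<beta> \<subseteq> \<sigma> then c else 1)"
proof (rule cube_polyI)
  let ?E = "\<lambda>\<gamma>. (if \<gamma> = {} then 1 else 0) + (if \<gamma> = \<beta> then c - 1 else 0)"
  have "c \<in> I 0" using add_mem[OF antimono_mem[OF assms(2), of 0] one_mem] by simp
  then show "?E \<gamma> \<in> I (card \<gamma>)" for \<gamma>
    using assms by auto
  show "(if \<beta> \<subseteq> \<sigma> then c else 1) = (\<Sum>\<gamma>\<in>Pow \<sigma>. ?E \<gamma>)" if "finite \<sigma>" for \<sigma>
    using that by (simp add: sum.distrib)
qed

lemma cube_poly_const: "c \<in> I 0 \<Longrightarrow> cube_poly (\<lambda>_. c)"
  by (rule cube_polyI[where E = "\<lambda>\<gamma>. if \<gamma> = {} then c else 0"]) auto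

lemma cube_poly_letter:
  assumes "a \<in> I 0" "b - a \<in> I 1"
  shows "cube_poly (\<lambda>\<sigma>. if q \<in> \<sigma> then b else a)"
proof (rule cube_polyI)
  let ?E = "\<lambda>\<gamma>. (if \<gamma> = {} then a else 0) + (if \<gamma> = {q} then b - a else 0)"
  show "?E \<gamma> \<in> I (card \<gamma>)" for \<gamma>
    using assms by (auto intro: add_mem)
  show "(if q \<in> \<sigma> then b else a) = (\<Sum>\<gamma>\<in>Pow \<sigma>. ?E \<gamma>)" if "finite \<sigma>" for \<sigma>
    using that by (simp add: sum.distrib)
qed

lemma cube_poly_add:
  assumes "cube_poly x" "cube_poly y"
  shows "cube_poly (\<lambda>\<sigma>. x \<sigma> + y \<sigma>)"
proof -
  obtain E where E: "\<And>\<beta>. finite \<beta> \<Longrightarrow> E \<beta> \<in> I (card \<beta>)"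
    and x: "\<And>\<sigma>. finite \<sigma> \<Longrightarrow> x \<sigma> = (\<Sum>\<beta>\<in>Pow \<sigma>. E \<beta>)"
    using assms(1) unfolding cube_poly_def by blast
  obtain F where F: "\<And>\<beta>. finite \<beta> \<Longrightarrow> F \<beta> \<in> I (card \<beta>)"
    and y: "\<And>\<sigma>. finite \<sigma> \<Longrightarrow> y \<sigma> = (\<Sum>\<beta>\<in>Pow \<sigma>. F \<beta>)"
    using assms(2) unfolding cube_poly_def by blast
  show ?thesis
    by (rule cube_polyI[where E = "\<lambda>\<beta>. E \<beta> + F \<beta>"])
      (auto simp: E F x y sum.distrib intro: add_mem)
qed

text \<open>Pairs of coefficients are collected by their union: those with union \<beta> have
  cardinalities adding up to at least \<open>card \<beta>\<close>, so overlaps do no harm. The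
  factors need not commute.\<close>

lemma cube_poly_mult:
  assumes "cube_poly x" "cube_poly y"
  shows "cube_poly (\<lambda>\<sigma>. x \<sigma> * y \<sigma>)"
proof -
  obtain E where E: "\<And>\<beta>. finite \<beta> \<Longrightarrow> E \<beta> \<in> I (card \<beta>)"
    and x: "\<And>\<sigma>. finite \<sigma> \<Longrightarrow> x \<sigma> = (\<Sum>\<beta>\<in>Pow \<sigma>. E \<beta>)"
    using assms(1) unfolding cube_poly_def by blast
  obtain F where F: "\<And>\<beta>. finite \<beta> \<Longrightarrow> F \<beta> \<in> I (card \<beta>)"
    and y: "\<And>\<sigma>. finite \<sigma> \<Longrightarrow> y \<sigma> = (\<Sum>\<beta>\<in>Pow \<sigma>. F \<beta>)"
    using assms(2) unfolding cube_poly_def by blast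
  let ?T = "\<lambda>\<beta>. {p \<in> Pow \<beta> \<times> Pow \<beta>. fst p \<union> snd p = \<beta>}"
  show ?thesis
  proof (rule cube_polyI[where E = "\<lambda>\<beta>. \<Sum>p\<in>?T \<beta>. E (fst p) * F (snd p)"])
    fix \<beta> :: "'a set" assume fin: "finite \<beta>"
    show "(\<Sum>p\<in>?T \<beta>. E (fst p) * F (snd p)) \<in> I (card \<beta>)"
    proof (rule sum_mem)
      fix p assume "p \<in> ?T \<beta>"
      then have p: "fst p \<subseteq> \<beta>" "snd p \<subseteq> \<beta>" "fst p \<union> snd p = \<beta>" by auto
      have "E (fst p) * F (snd p) \<in> I (card (fst p) + card (snd p))"
        using p fin by (intro mult_mem E F) (auto intro: finite_subset)
      moreover have "card \<beta> \<le> card (fst p) + card (snd p)"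
        using card_Un_le[of "fst p" "snd p"] p by simp
      ultimately show "E (fst p) * F (snd p) \<in> I (card \<beta>)"
        by (rule antimono_mem)
    qed
  next
    fix \<sigma> :: "'a set" assume fin: "finite \<sigma>"
    have "x \<sigma> * y \<sigma> = (\<Sum>p\<in>Pow \<sigma> \<times> Pow \<sigma>. E (fst p) * F (snd p))"
      using fin by (simp add: x y sum_product sum.cartesian_product case_prod_unfold)
    also have "\<dots> = (\<Sum>\<beta>\<in>Pow \<sigma>. \<Sum>p\<in>{p \<in> Pow \<sigma> \<times> Pow \<sigma>. fst p \<union> snd p = \<beta>}. E (fst p) * F (snd p))"
      using fin by (intro sum.group[symmetric]) auto
    also have "\<dots> = (\<Sum>\<beta>\<in>Pow \<sigma>. \<Sum>p\<in>?T \<beta>. E (fst p) * F (snd p))"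
      by (intro sum.cong refl) auto
    finally show "x \<sigma> * y \<sigma> = (\<Sum>\<beta>\<in>Pow \<sigma>. \<Sum>p\<in>?T \<beta>. E (fst p) * F (snd p))" .
  qed
qed

lemma cube_poly_diff:
  assumes "cube_poly x" "cube_poly y"
  shows "cube_poly (\<lambda>\<sigma>. x \<sigma> - y \<sigma>)"
  using cube_poly_add[OF assms(1) cube_poly_mult[OF cube_poly_const[of "- 1"] assms(2)]]
  by (simp add: uminus_mem)

lemma cube_poly_Int:
  assumes "cube_poly x"
  shows "cube_poly (\<lambda>\<sigma>. x (\<sigma> \<inter> S))"
proof -
  obtain E where E: "\<And>\<beta>. finite \<beta> \<Longrightarrow> E \<beta> \<in> I (card \<beta>)"
    and x: "\<And>\<sigma>. finite \<sigma> \<Longrightarrow> x \<sigma> = (\<Sum>\<beta>\<in>Pow \<sigma>. E \<beta>)"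
    using assms(1) unfolding cube_poly_def by blast
  show ?thesis
  proof (rule cube_polyI[where E = "\<lambda>\<beta>. if \<beta> \<subseteq> S then E \<beta> else 0"])
    fix \<sigma> :: "'a set" assume fin: "finite \<sigma>"
    have "Pow (\<sigma> \<inter> S) = {\<beta> \<in> Pow \<sigma>. \<beta> \<subseteq> S}" by auto
    then show "x (\<sigma> \<inter> S) = (\<Sum>\<beta>\<in>Pow \<sigma>. if \<beta> \<subseteq> S then E \<beta> else 0)"
      using fin by (simp only: x finite_Int disjI1 sum.inter_filter finite_Pow_iff)
  qed (simp add: E)
qed

lemma cube_poly_vimage:
  assumes "cube_poly x" "inj f"
  shows "cube_poly (\<lambda>\<sigma>. x (f -` \<sigma>))"
proof -
  obtain E where E: "\<And>\<beta>. finite \<beta> \<Longrightarrow> E \<beta> \<in> I (card \<beta>)"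
    and x: "\<And>\<sigma>. finite \<sigma> \<Longrightarrow> x \<sigma> = (\<Sum>\<beta>\<in>Pow \<sigma>. E \<beta>)"
    using assms(1) unfolding cube_poly_def by blast
  show ?thesis
  proof (rule cube_polyI[where E = "\<lambda>\<beta>. if \<beta> \<subseteq> range f then E (f -` \<beta>) else 0"])
    show "(if \<beta> \<subseteq> range f then E (f -` \<beta>) else 0) \<in> I (card \<beta>)" if "finite \<beta>" for \<beta>
    proof (cases "\<beta> \<subseteq> range f")
      case True
      then have "card (f -` \<beta>) = card \<beta>" using assms(2) by (simp add: card_vimage_inj)
      then show ?thesis using E[of "f -` \<beta>"] finite_vimageI[OF that assms(2)] True by simp
    qed simp
  next
    fix \<sigma> :: "'b set" assume fin: "finite \<sigma>"
    have "x (f -` \<sigma>) = (\<Sum>\<beta>\<in>Pow (f -` \<sigma>). E \<beta>)"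
      using finite_vimageI[OF fin assms(2)] by (rule x)
    also have "\<dots> = (\<Sum>\<beta>\<in>{\<beta> \<in> Pow \<sigma>. \<beta> \<subseteq> range f}. E (f -` \<beta>))"
      using assms(2) by (intro sum.reindex_bij_witness[of _ "vimage f" "image f"])
        (auto simp: inj_vimage_image_eq)
    also have "\<dots> = (\<Sum>\<beta>\<in>Pow \<sigma>. if \<beta> \<subseteq> range f then E (f -` \<beta>) else 0)"
      using fin by (intro sum.inter_filter) simp
    finally show "x (f -` \<sigma>) = (\<Sum>\<beta>\<in>Pow \<sigma>. if \<beta> \<subseteq> range f then E (f -` \<beta>) else 0)" .
  qed
qed

text \<open>This is the geometric series for the inverse of y = 1 - (1 - y), cut off where the
  powers of 1 - y enter \<open>I D\<close>. Being a polynomial expression in y, it preserves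
  \<open>cube_poly\<close>, which an arbitrary choice of inverses modulo \<open>I D\<close> would
  not guarantee.\<close>

definition uinv :: "nat \<Rightarrow> 'r \<Rightarrow> 'r" where
  "uinv D y = (\<Sum>k<D. (1 - y) ^ k)"

lemma uinv_right: "y - 1 \<in> I 1 \<Longrightarrow> y * uinv D y - 1 \<in> I D"
proof -
  assume y: "y - 1 \<in> I 1"
  have "y * uinv D y - 1 = - ((1 - y) ^ D)"
    unfolding uinv_def
  proof (induction D)
    case (Suc D)
    then show ?case by (simp add: algebra_simps)
  qed simp
  then show ?thesis
    using power_mem[of "1 - y" D] uminus_mem[OF y] by (simp add: uminus_mem)
qed

lemma uinv_left: "y - 1 \<in> I 1 \<Longrightarrow> uinv D y * y - 1 \<in> I D"
proof -
  assume y: "y - 1 \<in> I 1"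
  have "uinv D y * y - 1 = - ((1 - y) ^ D)"
    unfolding uinv_def
  proof (induction D)
    case (Suc D)
    have "(1 - y) ^ D * y - (1 - y) ^ D = - ((1 - y) ^ Suc D)"
      by (simp only: power_Suc2) (simp add: algebra_simps)
    then show ?case using Suc by (simp add: algebra_simps)
  qed simp
  then show ?thesis
    using power_mem[of "1 - y" D] uminus_mem[OF y] by (simp add: uminus_mem)
qed

lemma uinv_mem: "y - 1 \<in> I 1 \<Longrightarrow> uinv D y \<in> I 0"
  unfolding uinv_def using uminus_mem[of "y - 1" 1]
  by (intro sum_mem) (metis antimono_mem le0 minus_diff_eq power_mem)

lemma cube_poly_uinv:
  assumes "cube_poly x"
  shows "cube_poly (\<lambda>\<sigma>. uinv D (x \<sigma>))"
proof -
  have pow: "cube_poly (\<lambda>\<sigma>. (1 - x \<sigma>) ^ k)" for k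
  proof (induction k)
    case (Suc k)
    then show ?case
      using cube_poly_mult[OF cube_poly_diff[OF cube_poly_const[of 1] assms]] by simp
  qed (simp add: cube_poly_const)
  show ?thesis unfolding uinv_def
  proof (induction D)
    case (Suc D)
    then show ?case using cube_poly_add[OF _ pow] by simp
  qed (simp add: cube_poly_const)
qed

subsection \<open>Groups of unipotent elements modulo a filtration step\<close>

text \<open>A subgroup of 1 + \<open>I 1\<close> modulo \<open>I D\<close>, represented by the union
  of its cosets so that congruences can be used freely. Inverses are asked for on one side only,
  which is the form in which the compactness argument supplies them.\<close>

definition ugroup :: "nat \<Rightarrow> 'r set \<Rightarrow> bool" where
  "ugroup D H \<longleftrightarrow> 1 \<in> H \<and> (\<forall>c\<in>H. c - 1 \<in> I 1) \<and> (\<forall>c\<in>H. \<forall>c'\<in>H. c * c' \<in> H) \<and>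
     (\<forall>c\<in>H. \<forall>c'. c' - c \<in> I D \<longrightarrow> c' \<in> H) \<and> (\<forall>c\<in>H. \<exists>c'\<in>H. c' * c - 1 \<in> I D)"

context
  fixes D :: nat and H :: "'r set"
  assumes H: "ugroup D H" and D: "1 \<le> D"
begin

lemma ugroup_I0: "c \<in> H \<Longrightarrow> c \<in> I 0"
  using H add_mem[of "c - 1" 0 1] antimono_mem[of "c - 1" 1 0] unfolding ugroup_def by auto

lemma ugroup_mult: "c \<in> H \<Longrightarrow> c' \<in> H \<Longrightarrow> c * c' \<in> H"
  using H unfolding ugroup_def by blast

lemma ugroup_cong: "c \<in> H \<Longrightarrow> c' - c \<in> I D \<Longrightarrow> c' \<in> H"
  using H unfolding ugroup_def by blast

lemma ugroup_unipotent: "c \<in> H \<Longrightarrow> c - 1 \<in> I 1"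
  using H unfolding ugroup_def by blast

lemma ugroup_one: "1 \<in> H"
  using H unfolding ugroup_def by blast

text \<open>Associativity of c' c \<open>uinv D c\<close> identifies the left inverse c' with the
  right inverse \<open>uinv D c\<close> modulo \<open>I D\<close>, so the polynomial formula for the
  inverse stays in H.\<close>

lemma ugroup_uinv:
  assumes c: "c \<in> H"
  shows "uinv D c \<in> H"
proof -
  obtain c' where c': "c' \<in> H" "c' * c - 1 \<in> I D"
    using H c unfolding ugroup_def by blast
  have "c' * (c * uinv D c) - c' * 1 \<in> I D"
    using mult_mem_left[OF ugroup_I0[OF c'(1)] uinv_right[OF ugroup_unipotent[OF c]]]
    by (simp add: algebra_simps)
  moreover have "(c' * c) * uinv D c - 1 * uinv D c \<in> I D"
    using mult_mem_right[OF c'(2) uinv_mem[OF ugroup_unipotent[OF c], of D]]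
    by (simp add: algebra_simps)
  ultimately have "uinv D c - c' \<in> I D"
    using cong_trans cong_sym by (metis mult.assoc mult_1 mult.right_neutral)
  then show ?thesis using ugroup_cong c'(1) by blast
qed

lemma cube_generation:
  assumes "finite S" "cube_poly h" "h {} - 1 \<in> I D"
    and "\<And>\<beta>. \<beta> \<subseteq> S \<Longrightarrow> card \<beta> < D \<Longrightarrow> h \<beta> \<in> H"
  shows "h S \<in> H"
proof -
  \<comment> \<open>Divide \<open>h\<close> by its value at a minimal set where it is not yet trivial; this only changes the
    values at larger sets.\<close>
  have main: "h S \<in> H"
    if "\<BB> \<subseteq> Pow S" "\<And>\<beta> \<gamma>. \<beta> \<in> \<BB> \<Longrightarrow> \<beta> \<subseteq> \<gamma> \<Longrightarrow> \<gamma> \<subseteq> S \<Longrightarrow> \<gamma> \<in> \<BB>"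
      "\<And>\<beta>. \<beta> \<subseteq> S \<Longrightarrow> \<beta> \<notin> \<BB> \<Longrightarrow> h \<beta> - 1 \<in> I D" "{} \<notin> \<BB>"
      "cube_poly h" "\<And>\<beta>. \<beta> \<subseteq> S \<Longrightarrow> card \<beta> < D \<Longrightarrow> h \<beta> \<in> H" for \<BB> h
    using that
  proof (induction "card \<BB>" arbitrary: \<BB> h)
    case 0
    then have "\<BB> = {}" using assms(1) by (metis card_0_eq finite_Pow_iff finite_subset)
    then show ?case using 0(4)[of S] ugroup_cong[OF ugroup_one] by simp
  next
    case (Suc n)
    have finB: "finite \<BB>" using Suc.prems(1) assms(1) finite_subset by blast
    have "\<BB> \<noteq> {}" using Suc.hyps(2) by auto
    then obtain \<beta> where \<beta>: "\<beta> \<in> \<BB>" and min: "\<And>\<gamma>. \<gamma> \<in> \<BB> \<Longrightarrow> \<gamma> \<subseteq> \<beta> \<Longrightarrow> \<gamma> = \<beta>"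
      using finite_has_minimal[OF finB] by metis
    have \<beta>S: "\<beta> \<subseteq> S" using \<beta> Suc.prems(1) by blast
    have fin\<beta>: "finite \<beta>" using \<beta>S assms(1) finite_subset by blast
    have "\<beta> \<noteq> {}" using \<beta> Suc.prems(4) by auto
    obtain E where E: "\<And>\<beta>. finite \<beta> \<Longrightarrow> E \<beta> \<in> I (card \<beta>)"
      and x: "\<And>\<sigma>. finite \<sigma> \<Longrightarrow> h \<sigma> = (\<Sum>\<beta>\<in>Pow \<sigma>. E \<beta>)"
      using Suc.prems(5) unfolding cube_poly_def by blast
    have E0: "E {} - 1 \<in> I D"
      using Suc.prems(3)[of "{}"] Suc.prems(4) x[of "{}"] by simp
    \<comment> \<open>Triangularity of Moebius inversion: h is trivial on all proper subsets of
      \<beta>, so by induction on size the coefficients strictly between the empty set and \<beta>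
      lie in \<open>I D\<close>. Hence h \<beta> is congruent to 1 + E \<beta>.\<close>
    have small: "E \<gamma> \<in> I D" if "\<gamma> \<subset> \<beta>" "\<gamma> \<noteq> {}" for \<gamma>
      using that
    proof (induction "card \<gamma>" arbitrary: \<gamma> rule: less_induct)
      case less
      have fin: "finite \<gamma>" using less.prems fin\<beta> finite_subset by blast
      have "h \<gamma> - 1 \<in> I D"
        using Suc.prems(3)[of \<gamma>] min[of \<gamma>] less.prems \<beta>S by blast
      moreover have "h \<gamma> = E \<gamma> + (E {} + (\<Sum>\<delta>\<in>Pow \<gamma> - {\<gamma>, {}}. E \<delta>))"
      proof -
        have "h \<gamma> = E \<gamma> + (\<Sum>\<delta>\<in>Pow \<gamma> - {\<gamma>}. E \<delta>)"
          using fin by (simp add: x sum.remove[of "Pow \<gamma>" \<gamma>])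
        also have "(\<Sum>\<delta>\<in>Pow \<gamma> - {\<gamma>}. E \<delta>) = E {} + (\<Sum>\<delta>\<in>Pow \<gamma> - {\<gamma>} - {{}}. E \<delta>)"
          using fin less.prems by (intro sum.remove) auto
        finally show ?thesis by (simp add: insert_commute flip: Diff_insert)
      qed
      moreover have "(\<Sum>\<delta>\<in>Pow \<gamma> - {\<gamma>, {}}. E \<delta>) \<in> I D"
      proof (rule sum_mem)
        fix \<delta> assume "\<delta> \<in> Pow \<gamma> - {\<gamma>, {}}"
        then have "\<delta> \<subset> \<gamma>" "\<delta> \<noteq> {}" by auto
        then show "E \<delta> \<in> I D"
          using less.prems psubset_card_mono[OF fin] by (intro less.hyps) auto
      qed
      ultimately have "(h \<gamma> - 1) - (E {} - 1) - (\<Sum>\<delta>\<in>Pow \<gamma> - {\<gamma>, {}}. E \<delta>) \<in> I D"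
        using E0 diff_mem by blast
      then show ?case using \<open>h \<gamma> = _\<close> by simp
    qed
    have h\<beta>: "h \<beta> - 1 - E \<beta> \<in> I D"
    proof -
      have "h \<beta> = E \<beta> + (\<Sum>\<delta>\<in>Pow \<beta> - {\<beta>}. E \<delta>)"
        using fin\<beta> by (simp add: x sum.remove[of "Pow \<beta>" \<beta>])
      also have "(\<Sum>\<delta>\<in>Pow \<beta> - {\<beta>}. E \<delta>) = E {} + (\<Sum>\<delta>\<in>Pow \<beta> - {\<beta>} - {{}}. E \<delta>)"
        using fin\<beta> \<open>\<beta> \<noteq> {}\<close> by (intro sum.remove) auto
      finally have "h \<beta> - 1 - E \<beta> = (E {} - 1) + (\<Sum>\<delta>\<in>Pow \<beta> - {\<beta>} - {{}}. E \<delta>)"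
        by simp
      moreover have "(\<Sum>\<delta>\<in>Pow \<beta> - {\<beta>} - {{}}. E \<delta>) \<in> I D"
        by (intro sum_mem small) auto
      ultimately show ?thesis using E0 by (simp only: add_mem)
    qed
    have up: "\<gamma> \<in> \<BB> - {\<beta>}" if "\<delta> \<in> \<BB> - {\<beta>}" "\<delta> \<subseteq> \<gamma>" "\<gamma> \<subseteq> S" for \<delta> \<gamma>
      using Suc.prems(2) min that by blast
    have card: "n = card (\<BB> - {\<beta>})" using Suc.hyps(2) \<beta> finB by simp
    show ?case
    proof (cases "card \<beta> < D")
      \<comment> \<open>From size D on, \<open>E \<beta>\<close> already lies in \<open>I D\<close>
        and h \<beta> is trivial without any correction, so membership in H is only ever asked for
        below size D.\<close>
      case False
      then have "E \<beta> \<in> I D" using E[OF fin\<beta>] antimono_mem by (metis not_less)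
      then have "h \<beta> - 1 \<in> I D" using add_mem[OF h\<beta>] by fastforce
      then have "h \<gamma> - 1 \<in> I D" if "\<gamma> \<subseteq> S" "\<gamma> \<notin> \<BB> - {\<beta>}" for \<gamma>
        using Suc.prems(3)[of \<gamma>] that by (cases "\<gamma> = \<beta>") auto
      moreover have "\<BB> - {\<beta>} \<subseteq> Pow S" "{} \<notin> \<BB> - {\<beta>}" using Suc.prems(1,4) by auto
      ultimately show ?thesis
        using Suc.hyps(1)[OF card] up Suc.prems(5,6) by metis
    next
      case True
      define c where "c = h \<beta>"
      define c' where "c' = uinv D c"
      have cH: "c \<in> H" using Suc.prems(6)[OF \<beta>S True] by (simp add: c_def)
      have c'H: "c' \<in> H" using ugroup_uinv[OF cH] by (simp add: c'_def)
      have cc': "c * c' - 1 \<in> I D" "c' * c - 1 \<in> I D"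
        using uinv_left uinv_right ugroup_unipotent[OF cH] by (auto simp: c'_def)
      \<comment> \<open>The correction has to be 1 modulo \<open>I (card \<beta>)\<close>, not just
        modulo \<open>I 1\<close>, for the map that applies it above \<beta> to be
        polynomial.\<close>
      have "c - 1 \<in> I (card \<beta>)"
        using add_mem[OF antimono_mem[OF h\<beta>, of "card \<beta>"] E[OF fin\<beta>]] True by (simp add: c_def)
      then have "c' * (c - 1) \<in> I (card \<beta>)"
        using mult_mem_left[OF ugroup_I0[OF c'H]] by blast
      moreover have "c' * c - 1 \<in> I (card \<beta>)" using cc'(2) antimono_mem True by (meson less_imp_le)
      ultimately have "(c' * c - 1) - c' * (c - 1) \<in> I (card \<beta>)" using diff_mem by blast
      then have c'1: "c' - 1 \<in> I (card \<beta>)" by (simp add: algebra_simps)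
      define h' where "h' \<sigma> = (if \<beta> \<subseteq> \<sigma> then c' else 1) * h \<sigma>" for \<sigma>
      have "h' S \<in> H"
      proof (rule Suc.hyps(1)[OF card _ up])
        show "\<BB> - {\<beta>} \<subseteq> Pow S" "{} \<notin> \<BB> - {\<beta>}" using Suc.prems by auto
        show "h' \<gamma> - 1 \<in> I D" if "\<gamma> \<subseteq> S" "\<gamma> \<notin> \<BB> - {\<beta>}" for \<gamma>
        proof (cases "\<gamma> = \<beta>")
          case True
          then show ?thesis using cc' by (simp add: h'_def c_def)
        next
          case False
          then have "\<not> \<beta> \<subseteq> \<gamma>" using Suc.prems(2)[OF \<beta>, of \<gamma>] that by auto
          then show ?thesis using Suc.prems(3)[of \<gamma>] that False by (auto simp: h'_def)
        qed
        show "cube_poly h'"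
          unfolding h'_def using cube_poly_mult[OF cube_poly_step[OF fin\<beta> c'1] Suc.prems(5)] .
        show "h' \<gamma> \<in> H" if "\<gamma> \<subseteq> S" "card \<gamma> < D" for \<gamma>
          using Suc.prems(6)[OF that] c'H by (auto simp: h'_def intro: ugroup_mult)
      qed (use \<beta> in auto)
      then have "c * (c' * h S) \<in> H" using ugroup_mult[OF cH] \<beta>S by (simp add: h'_def)
      moreover have "h S - c * (c' * h S) \<in> I D"
      proof -
        have "(c * c' - 1) * h S \<in> I D"
          using mult_mem_right[OF cc'(1) cube_poly_mem[OF Suc.prems(5) assms(1)]] .
        then show ?thesis using uminus_mem by (fastforce simp: algebra_simps)
      qed
      ultimately show ?thesis using ugroup_cong by blast
    qed
  qed
  show ?thesis
  proof (rule main[of "Pow S - {{}}" h])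
    show "h \<beta> - 1 \<in> I D" if "\<beta> \<subseteq> S" "\<beta> \<notin> Pow S - {{}}" for \<beta>
      using that assms(3) by auto
  qed (use assms in auto)
qed

theorem cube_straddle:
  assumes fin: "finite A" "finite B" and x: "cube_poly x" and x0: "x {} = 1"
    and eq: "x A = x (A \<union> B)" and xM: "x (A \<inter> B) \<in> H"
    and gen: "\<And>\<beta> \<gamma>. \<beta> \<subseteq> A \<union> B \<Longrightarrow> \<not> \<beta> \<subseteq> A \<Longrightarrow> \<not> \<beta> \<subseteq> B \<Longrightarrow> card \<beta> < D \<Longrightarrow> \<gamma> \<subseteq> \<beta> \<Longrightarrow> x \<gamma> \<in> H"
  shows "x B \<in> H"
proof -
  \<comment> \<open>\<open>h\<close> is trivial on the subsets of \<open>A\<close> and on those of \<open>B\<close>, so only straddling sets contribute.\<close>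
  define h where "h \<sigma> = (uinv D (x (\<sigma> \<inter> A)) * x \<sigma>) * (uinv D (x (\<sigma> \<inter> B)) * x (\<sigma> \<inter> (A \<inter> B)))" for \<sigma>
  have uni: "x \<sigma> - 1 \<in> I 1" if "finite \<sigma>" for \<sigma>
    using cube_poly_diff_empty_mem[OF x that] x0 by simp
  have I0: "x \<sigma> \<in> I 0" if "finite \<sigma>" for \<sigma> using cube_poly_mem[OF x that] .
  have hpoly: "cube_poly h"
    unfolding h_def by (intro cube_poly_mult cube_poly_uinv cube_poly_Int x)
  have prod1: "a * b - 1 \<in> I D" if "a - 1 \<in> I D" "b - 1 \<in> I D" for a b
  proof -
    have "b \<in> I 0" using add_mem[OF antimono_mem[OF that(2), of 0] one_mem] by simp
    then show ?thesis using cong_mult[OF that] by simp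
  qed
  have trivA: "h \<sigma> - 1 \<in> I D" if "\<sigma> \<subseteq> A" for \<sigma>
  proof -
    have "\<sigma> \<inter> A = \<sigma>" "\<sigma> \<inter> (A \<inter> B) = \<sigma> \<inter> B" using that by auto
    moreover have "finite \<sigma>" using that fin finite_subset by blast
    ultimately show ?thesis unfolding h_def by (auto intro!: prod1 uinv_left uni)
  qed
  \<comment> \<open>Here h \<sigma> reads
    \<open>(uinv D ?m * x \<sigma>) * (uinv D (x \<sigma>) * ?m)\<close> and cancels from the inside
    out, whereas on subsets of A the two brackets cancel separately. The order of the factors of
    \<open>h\<close> serves both cases without commutativity.\<close>
  have trivB: "h \<sigma> - 1 \<in> I D" if "\<sigma> \<subseteq> B" for \<sigma>
  proof -
    have e: "\<sigma> \<inter> B = \<sigma>" "\<sigma> \<inter> (A \<inter> B) = \<sigma> \<inter> A" using that by auto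
    have f: "finite \<sigma>" using that fin finite_subset by blast
    let ?m = "x (\<sigma> \<inter> A)"
    have m: "?m - 1 \<in> I 1" "?m \<in> I 0" using f uni I0 by auto
    have "(x \<sigma> * uinv D (x \<sigma>) - 1) \<in> I D" using uinv_right uni f by blast
    then have "uinv D ?m * ((x \<sigma> * uinv D (x \<sigma>) - 1) * ?m) \<in> I D"
      by (intro mult_mem_left mult_mem_right uinv_mem m)
    moreover have "uinv D ?m * ?m - 1 \<in> I D" using uinv_left m by blast
    ultimately have "uinv D ?m * ((x \<sigma> * uinv D (x \<sigma>) - 1) * ?m) + (uinv D ?m * ?m - 1) \<in> I D"
      by (rule add_mem)
    then show ?thesis unfolding h_def e by (simp add: algebra_simps)
  qed
  have "h (A \<union> B) \<in> H"
  proof (rule cube_generation[OF _ hpoly])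
    show "h {} - 1 \<in> I D" using trivA by simp
    show "h \<beta> \<in> H" if b: "\<beta> \<subseteq> A \<union> B" "card \<beta> < D" for \<beta>
    proof (cases "\<beta> \<subseteq> A \<or> \<beta> \<subseteq> B")
      case True
      then show ?thesis using trivA trivB ugroup_cong[OF ugroup_one] by blast
    next
      case False
      \<comment> \<open>The value h \<beta> uses x at \<beta> and at its intersections with A, B and
        A \<inter> B, which is why \<open>gen\<close> speaks of all subsets \<gamma> of
        \<beta>.\<close>
      then have "x \<gamma> \<in> H" if "\<gamma> \<subseteq> \<beta>" for \<gamma> using gen b that by blast
      then show ?thesis unfolding h_def by (intro ugroup_mult ugroup_uinv) auto
    qed
  qed (use fin in auto)
  \<comment> \<open>By \<open>eq\<close> the first bracket of h (A \<union> B) is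
    \<open>uinv D (x A) * x A\<close>, congruent to 1. So x A disappears although it is not known to
    lie in H.\<close>
  moreover have "uinv D (x B) * x (A \<inter> B) - h (A \<union> B) \<in> I D"
  proof -
    have "(A \<union> B) \<inter> A = A" "(A \<union> B) \<inter> B = B" "(A \<union> B) \<inter> (A \<inter> B) = A \<inter> B" by auto
    then have "h (A \<union> B) - uinv D (x B) * x (A \<inter> B)
      = (uinv D (x A) * x A - 1) * (uinv D (x B) * x (A \<inter> B))"
      by (simp add: h_def eq algebra_simps)
    also have "\<dots> \<in> I D"
      using fin by (intro mult_mem_right[OF uinv_left] mult_mem_left uinv_mem uni I0) auto
    finally show ?thesis by (rule cong_sym)
  qed
  ultimately have k: "uinv D (x B) * x (A \<inter> B) \<in> H" (is "?k \<in> H") using ugroup_cong by blast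
  have "x (A \<inter> B) * uinv D ?k \<in> H" using k xM ugroup_mult ugroup_uinv by blast
  moreover have "x B - x (A \<inter> B) * uinv D ?k \<in> I D"
  proof -
    have "(x B * uinv D (x B) - 1) * (x (A \<inter> B) * uinv D ?k) \<in> I D"
      using fin by (intro mult_mem_right[OF uinv_right] mult_mem_left uinv_mem uni I0 ugroup_unipotent[OF k]) auto
    moreover have "x B * (?k * uinv D ?k - 1) \<in> I D"
      using fin by (intro mult_mem_left uinv_right I0 ugroup_unipotent[OF k]) auto
    ultimately have "(x B * uinv D (x B) - 1) * (x (A \<inter> B) * uinv D ?k) - x B * (?k * uinv D ?k - 1) \<in> I D"
      by (rule diff_mem)
    then show ?thesis by (simp add: algebra_simps)
  qed
  ultimately show ?thesis using ugroup_cong by blast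
qed

end

end

subsection \<open>Compactness\<close>

lemma compact_UNIV_fun: "compact (UNIV :: ('i \<Rightarrow> 'a::topological_space) set)"
  if "compact (UNIV :: 'a set)"
proof -
  have "compact_space (euclidean :: 'a topology)"
    using that by (simp add: compact_space_def)
  then have "compact_space (product_topology (\<lambda>_::'i. euclidean :: 'a topology) UNIV)"
    by (simp add: compact_space_product_topology)
  then show ?thesis
    by (simp add: euclidean_product_topology compact_space_def)
qed

text \<open>A minimal closed subsemigroup A satisfies A s = A for each s in A. Therefore the x in A
  with x s = s form a non-empty closed subsemigroup, which is all of A by minimality, and s itself
  is idempotent. The product is a parameter \<open>m\<close> so that componentwise products of pairs
  are covered.\<close>

theorem ellis_numakura:
  fixes m :: "'a::t2_space \<Rightarrow> 'a \<Rightarrow> 'a"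
  assumes "compact C" "C \<noteq> {}"
    and closed_m: "\<And>x y. x \<in> C \<Longrightarrow> y \<in> C \<Longrightarrow> m x y \<in> C"
    and assoc: "\<And>x y z. m (m x y) z = m x (m y z)"
    and cont: "\<And>y. continuous_on UNIV (\<lambda>x. m x y)"
  shows "\<exists>e\<in>C. m e e = e"
proof -
  define F where "F = {A. A \<subseteq> C \<and> closed A \<and> A \<noteq> {} \<and> (\<forall>x\<in>A. \<forall>y\<in>A. m x y \<in> A)}"
  have CF: "C \<in> F" using assms(2,3) compact_imp_closed[OF assms(1)] by (auto simp: F_def)
  have "\<exists>A\<in>F. \<forall>B\<in>F. B \<subseteq> A \<longrightarrow> B = A"
  proof -
    \<comment> \<open>Zorn's lemma is applied to complements, turning a minimal closed subsemigroup
      into a maximal open set.\<close>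
    have "\<exists>U\<in>uminus ` F. \<forall>X\<in>uminus ` F. U \<subseteq> X \<longrightarrow> X = U"
    proof (rule subset_Zorn_nonempty)
      show "uminus ` F \<noteq> {}" using CF by auto
      fix \<C> assume ne: "\<C> \<noteq> {}" and chain: "subset.chain (uminus ` F) \<C>"
      define \<D> where "\<D> = uminus ` \<C>"
      have \<D>: "\<D> \<subseteq> F" "\<D> \<noteq> {}"
        using ne chain by (auto simp: \<D>_def subset_chain_def)
      have tot: "A \<subseteq> B \<or> B \<subseteq> A" if "A \<in> \<D>" "B \<in> \<D>" for A B
      proof -
        have "- A \<in> \<C>" "- B \<in> \<C>" using that by (auto simp: \<D>_def)
        then show ?thesis using chain unfolding subset_chain_def by (metis Compl_subset_Compl_iff)
      qed
      have least: "\<exists>B\<in>\<E>. \<forall>A\<in>\<E>. B \<subseteq> A" if "finite \<E>" "\<E> \<noteq> {}" "\<E> \<subseteq> \<D>" for \<E>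
        using that
      proof (induction rule: finite_ne_induct)
        case (insert A \<E>)
        then obtain B where B: "B \<in> \<E>" "\<forall>A\<in>\<E>. B \<subseteq> A" by auto
        have "A \<in> \<D>" "B \<in> \<D>" using B insert.prems by auto
        then consider "A \<subseteq> B" | "B \<subseteq> A" using tot by blast
        then show ?case
        proof cases
          case 1
          then have "\<forall>A'\<in>insert A \<E>. A \<subseteq> A'" using B(2) by fast
          then show ?thesis by blast
        next
          case 2
          then have "\<forall>A'\<in>insert A \<E>. B \<subseteq> A'" using B(2) by fast
          then show ?thesis using B(1) by blast
        qed
      qed simp
      have "C \<inter> \<Inter>\<D> \<noteq> {}"
      proof (rule compact_imp_fip[OF assms(1)])
        show "closed A" if "A \<in> \<D>" for A using that \<D> by (auto simp: F_def)
        show "C \<inter> \<Inter>\<E> \<noteq> {}" if fin: "finite \<E>" and sub: "\<E> \<subseteq> \<D>" for \<E>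
        proof (cases "\<E> = {}")
          case False
          then obtain B where B: "B \<in> \<E>" "\<forall>A\<in>\<E>. B \<subseteq> A" using least[OF fin False sub] by blast
          then have "B \<in> F" using sub \<D> by blast
          then obtain z where "z \<in> B" "z \<in> C" unfolding F_def by blast
          have "z \<in> A" if "A \<in> \<E>" for A
            using bspec[OF B(2) that] \<open>z \<in> B\<close> by (rule subsetD)
          then have "z \<in> C \<inter> \<Inter>\<E>" using \<open>z \<in> C\<close> by (intro IntI InterI)
          then show ?thesis by (metis empty_iff)
        qed (use assms(2) in simp)
      qed
      then have "\<Inter>\<D> \<in> F"
      proof -
        obtain A\<^sub>0 where "A\<^sub>0 \<in> \<D>" using \<D>(2) by auto
        then have "\<Inter>\<D> \<subseteq> A\<^sub>0" "A\<^sub>0 \<subseteq> C" using \<D>(1) by (auto simp: F_def)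
        then have "\<Inter>\<D> \<subseteq> C" by (rule subset_trans)
        moreover have "closed (\<Inter>\<D>)" using \<D>(1) unfolding F_def by (intro closed_Inter) auto
        moreover have "m x y \<in> \<Inter>\<D>" if "x \<in> \<Inter>\<D>" "y \<in> \<Inter>\<D>" for x y
        proof
          fix A assume "A \<in> \<D>"
          then have "x \<in> A" "y \<in> A" "A \<in> F" using that \<D>(1) by auto
          then show "m x y \<in> A" by (simp add: F_def)
        qed
        ultimately show ?thesis using \<open>C \<inter> \<Inter>\<D> \<noteq> {}\<close> unfolding F_def by blast
      qed
      moreover have "\<Union>\<C> = - \<Inter>\<D>" by (auto simp: \<D>_def)
      ultimately show "\<Union>\<C> \<in> uminus ` F" by blast
    qed
    then obtain A where "A \<in> F" "\<forall>X\<in>uminus ` F. - A \<subseteq> X \<longrightarrow> X = - A" by blast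
    then show ?thesis by (intro bexI[of _ A]) auto
  qed
  then obtain A where A: "A \<in> F" and min: "\<And>B. B \<in> F \<Longrightarrow> B \<subseteq> A \<Longrightarrow> B = A" by blast
  obtain s where s: "s \<in> A" using A by (auto simp: F_def)
  have compA: "compact A" using A assms(1) unfolding F_def
    by (metis (no_types, lifting) compact_Int_closed inf.absorb2 mem_Collect_eq)
  let ?As = "(\<lambda>x. m x s) ` A"
  have AsA: "?As \<subseteq> A" using A s by (auto simp: F_def)
  have "?As \<in> F"
  proof -
    have "compact ?As"
      using compact_continuous_image[OF continuous_on_subset[OF cont] compA] by blast
    then have "closed ?As" by (rule compact_imp_closed)
    moreover have "m (m x s) (m y s) \<in> ?As" if "x \<in> A" "y \<in> A" for x y
    proof -
      have "m (m x s) (m y s) = m (m (m x s) y) s" by (simp add: assoc)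
      moreover have "m (m x s) y \<in> A" using A s that by (auto simp: F_def)
      ultimately show ?thesis by blast
    qed
    moreover have "?As \<noteq> {}" "?As \<subseteq> C" using AsA s A by (auto simp: F_def)
    ultimately show ?thesis unfolding F_def by blast
  qed
  then have "?As = A" using min AsA by blast
  then obtain t where t: "t \<in> A" "m t s = s" using s by (metis imageE)
  let ?B = "A \<inter> (\<lambda>x. m x s) -` {s}"
  have "closed ?B"
    using A cont by (intro closed_Int continuous_closed_vimage)
      (auto simp: F_def continuous_on_eq_continuous_at)
  then have "?B \<in> F" using A t by (auto simp: F_def assoc)
  then have "?B = A" using min by blast
  then have "m s s = s" using s by blast
  then show ?thesis using s A by (auto simp: F_def)
qed

text \<open>Two passages to the limit in a fixed order: first in the right factor, with the left
  factor in A where left multiplication is continuous, then in the left factor, with the right one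
  already a limit.\<close>

lemma closure_mult:
  fixes m :: "'a::topological_space \<Rightarrow> 'b::topological_space \<Rightarrow> 'c::topological_space"
  assumes right: "\<And>s. continuous_on UNIV (\<lambda>t. m t s)"
    and left: "\<And>t. t \<in> A \<Longrightarrow> continuous_on UNIV (m t)"
    and sub: "\<And>t s. t \<in> A \<Longrightarrow> s \<in> B \<Longrightarrow> m t s \<in> K"
    and "t \<in> closure A" "s \<in> closure B"
  shows "m t s \<in> closure K"
proof -
  have 1: "m t s \<in> closure K" if "t \<in> A" "s \<in> closure B" for t s
    using image_closure_subset[of B "m t" "closure K"] continuous_on_subset[OF left[OF that(1)]]
      sub[OF that(1)] closure_subset[of K] that(2) by blast
  show ?thesis
    using image_closure_subset[of A "\<lambda>t. m t s" "closure K"] continuous_on_subset[OF right]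
      1[OF _ assms(5)] assms(4) by blast
qed

subsection \<open>The circle group\<close>

text \<open>An additively written copy of the unit circle: functions into it then form an abelian
  group pointwise, and the additive maps between such functions a ring.\<close>

typedef circle = "sphere (0::complex) 1"
  by (rule exI[of _ 1]) simp

setup_lifting type_definition_circle

instantiation circle :: ab_group_add
begin
lift_definition zero_circle :: circle is 1 by simp
lift_definition plus_circle :: "circle \<Rightarrow> circle \<Rightarrow> circle" is "(*)" by (simp add: norm_mult)
lift_definition uminus_circle :: "circle \<Rightarrow> circle" is inverse by (simp add: norm_inverse)
lift_definition minus_circle :: "circle \<Rightarrow> circle \<Rightarrow> circle" is "(/)" by (simp add: norm_divide)
instance
  by standard (transfer; force simp: field_simps)+
end

instantiation circle :: metric_space
begin
definition dist_circle :: "circle \<Rightarrow> circle \<Rightarrow> real" where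
  "dist_circle x y = dist (Rep_circle x) (Rep_circle y)"
definition uniformity_circle :: "(circle \<times> circle) filter" where
  "uniformity_circle = (INF e\<in>{0 <..}. principal {(x, y). dist x y < e})"
definition open_circle :: "circle set \<Rightarrow> bool" where
  "open_circle U = (\<forall>x\<in>U. eventually (\<lambda>(x', y). x' = x \<longrightarrow> y \<in> U) uniformity)"
instance
proof
  show "dist x y = 0 \<longleftrightarrow> x = y" for x y :: circle
    by (simp add: dist_circle_def Rep_circle_inject)
  show "dist x y \<le> dist x z + dist y z" for x y z :: circle
    unfolding dist_circle_def by (rule dist_triangle2)
qed (simp_all add: uniformity_circle_def open_circle_def)
end

lemma continuous_on_Rep_circle [continuous_intros]:
  assumes "continuous_on S f" shows "continuous_on S (\<lambda>x. Rep_circle (f x))"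
  by (rule continuous_on_compose2[OF _ assms subset_UNIV])
    (auto simp: continuous_on_iff dist_circle_def)

lemma continuous_on_circleI:
  fixes f :: "'a::topological_space \<Rightarrow> circle"
  assumes "continuous_on S (\<lambda>x. Rep_circle (f x))" shows "continuous_on S f"
proof -
  have "continuous_on (range Rep_circle) Abs_circle"
    by (auto simp: continuous_on_iff dist_circle_def Rep_circle_inverse)
  from continuous_on_compose2[OF this assms] show ?thesis by (auto simp: Rep_circle_inverse)
qed

lemma compact_UNIV_circle: "compact (UNIV :: circle set)"
proof -
  have "continuous_on (sphere 0 1) Abs_circle"
    by (auto simp: continuous_on_iff dist_circle_def Abs_circle_inverse)
  then have "compact (Abs_circle ` sphere 0 1)"
    by (intro compact_continuous_image) auto
  then show ?thesis by (metis type_definition.Abs_image type_definition_circle)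
qed

lemma continuous_on_add_circle [continuous_intros]:
  fixes f g :: "'a::topological_space \<Rightarrow> circle"
  assumes "continuous_on S f" "continuous_on S g"
  shows "continuous_on S (\<lambda>x. f x + g x)"
  by (rule continuous_on_circleI) (auto simp: plus_circle.rep_eq intro!: continuous_intros assms)

lemma continuous_on_diff_circle [continuous_intros]:
  fixes f g :: "'a::topological_space \<Rightarrow> circle"
  assumes "continuous_on S f" "continuous_on S g"
  shows "continuous_on S (\<lambda>x. f x - g x)"
proof (rule continuous_on_circleI)
  have "Rep_circle z \<noteq> 0" for z using Rep_circle[of z] by auto
  then show "continuous_on S (\<lambda>x. Rep_circle (f x - g x))"
    by (auto simp: minus_circle.rep_eq intro!: continuous_intros assms)
qed

lift_definition circle_exp :: "real \<Rightarrow> circle" is "\<lambda>t. cis (2 * pi * t)" by simp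

lemma circle_exp_diff: "circle_exp (s - t) = circle_exp s - circle_exp t"
  by transfer (simp add: cis_divide algebra_simps)

lemma circle_exp_eq_0_iff: "circle_exp t = 0 \<longleftrightarrow> t \<in> \<int>"
proof
  assume "circle_exp t = 0"
  then have "cis (2 * pi * t) = 1" by transfer
  then have "cos (2 * pi * t) = 1" by (metis cis.simps(1) one_complex.simps(1))
  then obtain k :: int where "2 * pi * t = of_int k * 2 * pi" using cos_one_2pi_int by auto
  then have "t = of_int k" by simp
  then show "t \<in> \<int>" by simp
next
  assume "t \<in> \<int>"
  then show "circle_exp t = 0" by transfer (rule cis_multiple_2pi)
qed

lemma continuous_on_circle_exp: "continuous_on S circle_exp"
  by (rule continuous_on_circleI) (auto simp: circle_exp.rep_eq intro!: continuous_intros)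

text \<open>Modulo 1 every t has a representative in [-1/2, 1/2], where 0 is the only integer.
  Removing the \<epsilon>-ball around 0 leaves a compact set, possibly empty, on which
  \<open>circle_exp\<close> stays away from the neutral element.\<close>

lemma dist_to_int_small:
  assumes "\<epsilon> > 0"
  obtains \<delta> where "\<delta> > 0" "\<And>t. dist (circle_exp t) 0 < \<delta> \<Longrightarrow> dist_to_int t \<le> \<epsilon>"
proof -
  define K where "K = {-1/2..1/2 :: real} - {-\<epsilon><..<\<epsilon>}"
  have "compact K" unfolding K_def by (intro compact_diff) auto
  have "\<exists>\<delta>>0. \<forall>s\<in>K. \<delta> \<le> dist (circle_exp s) 0"
  proof (cases "K = {}")
    case False
    have "continuous_on K (\<lambda>s. dist (circle_exp s) 0)"
      by (intro continuous_on_dist continuous_on_circle_exp continuous_on_const)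
    then obtain s where s: "s \<in> K" "\<forall>s'\<in>K. dist (circle_exp s) 0 \<le> dist (circle_exp s') 0"
      using continuous_attains_inf[OF \<open>compact K\<close> False] by blast
    have "s \<notin> \<int>"
    proof
      assume "s \<in> \<int>"
      then obtain k :: int where k: "s = of_int k" by (elim Ints_cases)
      then have "k = 0" using s(1) by (auto simp: K_def)
      then show False using s(1) assms k by (simp add: K_def)
    qed
    then have "dist (circle_exp s) 0 > 0" by (simp add: circle_exp_eq_0_iff)
    then show ?thesis using s(2) by blast
  qed (auto intro: exI[of _ 1])
  then obtain \<delta> where \<delta>: "\<delta> > 0" "\<And>s. s \<in> K \<Longrightarrow> \<delta> \<le> dist (circle_exp s) 0" by blast
  show ?thesis
  proof
    fix t assume *: "dist (circle_exp t) 0 < \<delta>"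
    let ?s = "t - of_int (round t)"
    have "circle_exp ?s = circle_exp t" by (simp add: circle_exp_diff circle_exp_eq_0_iff)
    then have "?s \<notin> K" using \<delta>(2)[of ?s] * by auto
    moreover have "\<bar>?s\<bar> \<le> 1/2" using of_int_round_abs_le[of t] by (simp add: abs_minus_commute)
    ultimately show "dist_to_int t \<le> \<epsilon>" by (auto simp: K_def dist_to_int_def)
  qed fact
qed

subsection \<open>Endomorphisms\<close>

typedef endo = "{f :: (bool list \<Rightarrow> circle) \<Rightarrow> (bool list \<Rightarrow> circle). \<forall>x y. f (x + y) = f x + f y}"
  by (rule exI[of _ id]) simp

setup_lifting type_definition_endo

instantiation endo :: ring_1
begin
lift_definition zero_endo :: endo is "\<lambda>_. 0" by simp
lift_definition one_endo :: endo is "\<lambda>x. x" by simp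
lift_definition plus_endo :: "endo \<Rightarrow> endo \<Rightarrow> endo" is "\<lambda>f g x. f x + g x"
  by (simp add: algebra_simps)
lift_definition uminus_endo :: "endo \<Rightarrow> endo" is "\<lambda>f x. - f x"
  by (simp add: algebra_simps)
lift_definition minus_endo :: "endo \<Rightarrow> endo \<Rightarrow> endo" is "\<lambda>f g x. f x - g x"
  by (simp add: algebra_simps)
lift_definition times_endo :: "endo \<Rightarrow> endo \<Rightarrow> endo" is "\<lambda>f g x. f (g x)"
  by (simp add: algebra_simps)
instance
proof
  show "(0::endo) \<noteq> 1"
  proof
    assume "(0::endo) = 1"
    then have "Rep_endo 0 (\<lambda>_. circle_exp (1/2)) [] = Rep_endo 1 (\<lambda>_. circle_exp (1/2)) []" by simp
    then have "circle_exp (1/2) = 0" by (simp add: zero_endo.rep_eq one_endo.rep_eq)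
    then show False by transfer simp
  qed
qed (transfer; rule ext; simp add: algebra_simps; fail)+
end

abbreviation ap :: "endo \<Rightarrow> (bool list \<Rightarrow> circle) \<Rightarrow> bool list \<Rightarrow> circle" where
  "ap \<equiv> Rep_endo"

text \<open>The list of all values of T, as a point of a product of circles. Pulling the product
  topology back along it gives the topology of pointwise convergence.\<close>

definition coord :: "endo \<Rightarrow> (bool list \<Rightarrow> circle) \<times> bool list \<Rightarrow> circle" where
  "coord T = (\<lambda>x. ap T (fst x) (snd x))"

instantiation endo :: topological_space
begin
definition open_endo :: "endo set \<Rightarrow> bool" where
  "open_endo U = openin (pullback_topology UNIV coord euclidean) U"
instance
proof
  have "topspace (pullback_topology UNIV coord euclidean) = UNIV"
    by (simp add: topspace_pullback_topology)
  then show "open (UNIV :: endo set)"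
    unfolding open_endo_def by (metis openin_topspace)
qed (auto simp: open_endo_def)
end

lemma open_endo_iff: "open U \<longleftrightarrow> (\<exists>V. open V \<and> U = coord -` V)"
  by (simp add: open_endo_def openin_pullback_topology)

lemma continuous_on_coord: "continuous_on UNIV coord"
  unfolding continuous_on_open_vimage[OF open_UNIV] open_endo_iff by auto

lemma continuous_on_ap [continuous_intros]:
  assumes "continuous_on S f" shows "continuous_on S (\<lambda>x. ap (f x) \<phi> w)"
proof -
  have "continuous_on UNIV (\<lambda>T. ap T \<phi> w)"
    using continuous_on_product_then_coordinatewise[OF continuous_on_coord, of "(\<phi>, w)"]
    unfolding coord_def fst_conv snd_conv .
  from continuous_on_compose2[OF this assms subset_UNIV] show ?thesis .
qed

lemma continuous_on_endoI:
  fixes f :: "'a::topological_space \<Rightarrow> endo"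
  assumes "\<And>\<phi> w. continuous_on S (\<lambda>x. ap (f x) \<phi> w)"
  shows "continuous_on S f"
  unfolding continuous_on_open_invariant
proof (intro allI impI)
  fix U :: "endo set" assume "open U"
  then obtain V where V: "open V" "U = coord -` V" unfolding open_endo_iff by blast
  have "continuous_on S (\<lambda>x. coord (f x))"
    unfolding coord_def by (rule continuous_on_coordinatewise_then_product) (rule assms)
  then have "\<exists>A. open A \<and> A \<inter> S = (\<lambda>x. coord (f x)) -` V \<inter> S"
    unfolding continuous_on_open_invariant using V(1) by simp
  then show "\<exists>A. open A \<and> A \<inter> S = f -` U \<inter> S"
    unfolding V(2) vimage_comp comp_def .
qed

instance endo :: t2_space
proof
  fix S T :: endo assume "S \<noteq> T"
  then have "ap S \<noteq> ap T" by (simp add: Rep_endo_inject)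
  then obtain \<phi> w where "ap S \<phi> w \<noteq> ap T \<phi> w" unfolding fun_eq_iff by blast
  from hausdorff[OF this]
  obtain U V where UV: "open U" "open V" "ap S \<phi> w \<in> U" "ap T \<phi> w \<in> V" "U \<inter> V = {}"
    by (elim exE conjE)
  have "continuous_on UNIV (\<lambda>T. ap T \<phi> w)" by (rule continuous_on_ap[OF continuous_on_id])
  then have "open ((\<lambda>T. ap T \<phi> w) -` U)" "open ((\<lambda>T. ap T \<phi> w) -` V)"
    using UV(1,2) unfolding continuous_on_open_vimage[OF open_UNIV] by simp_all
  moreover have "(\<lambda>T. ap T \<phi> w) -` U \<inter> (\<lambda>T. ap T \<phi> w) -` V = {}"
    unfolding vimage_Int[symmetric] UV(5) by simp
  ultimately show "\<exists>U V. open U \<and> open V \<and> S \<in> U \<and> T \<in> V \<and> U \<inter> V = {}"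
    using UV(3,4) by (intro exI[of _ "(\<lambda>T. ap T \<phi> w) -` U"] exI[of _ "(\<lambda>T. ap T \<phi> w) -` V"]) simp
qed

lemma compact_UNIV_endo: "compact (UNIV :: endo set)"
proof -
  define K where "K = {F :: (bool list \<Rightarrow> circle) \<times> bool list \<Rightarrow> circle.
      \<forall>x y w. F (x + y, w) = F (x, w) + F (y, w)}"
  have K: "K = (\<Inter>x. \<Inter>y. \<Inter>w. {F. F (x + y, w) = F (x, w) + F (y, w)})"
    by (auto simp: K_def)
  have "closed K"
    unfolding K
    by (intro closed_INT ballI closed_Collect_eq continuous_on_add_circle continuous_on_product_coordinates)
  then have "compact (UNIV \<inter> K)"
    by (rule compact_Int_closed[OF compact_UNIV_fun[OF compact_UNIV_circle]])
  then have "compact K" by simp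
  define g where "g F = Abs_endo (\<lambda>\<phi> w. F (\<phi>, w))" for F
  have ap_g: "ap (g F) \<phi> w = F (\<phi>, w)" if "F \<in> K" for F \<phi> w
  proof -
    have "(\<lambda>\<phi> w. F (\<phi>, w)) \<in> {f. \<forall>x y. f (x + y) = f x + f y}"
      using that by (simp add: K_def fun_eq_iff)
    then show ?thesis unfolding g_def by (simp only: Abs_endo_inverse)
  qed
  have "continuous_on K (\<lambda>F. F (\<phi>, w))" for \<phi> :: "bool list \<Rightarrow> circle" and w
    by (rule continuous_on_subset[OF continuous_on_product_coordinates subset_UNIV])
  then have "continuous_on K (\<lambda>F. ap (g F) \<phi> w)" for \<phi> w
    by (subst continuous_on_cong[OF refl ap_g])
  then have "continuous_on K g" by (rule continuous_on_endoI)
  then have "compact (g ` K)" using \<open>compact K\<close> by (rule compact_continuous_image)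
  moreover have "g ` K = UNIV"
  proof -
    have "T \<in> g ` K" for T
    proof
      have "ap T (x + y) = ap T x + ap T y" for x y using Rep_endo[of T] by simp
      then show *: "coord T \<in> K" unfolding coord_def K_def by simp
      show "T = g (coord T)"
        unfolding Rep_endo_inject[symmetric] fun_eq_iff ap_g[OF *] by (simp add: coord_def)
    qed
    then show ?thesis by blast
  qed
  ultimately show ?thesis by simp
qed

lemma ap_simps [simp]:
  "ap (S + T) \<phi> = ap S \<phi> + ap T \<phi>" "ap (S - T) \<phi> = ap S \<phi> - ap T \<phi>"
  "ap (- T) \<phi> = - ap T \<phi>" "ap (S * T) \<phi> = ap S (ap T \<phi>)" "ap 0 \<phi> = 0" "ap 1 \<phi> = \<phi>"
  by (transfer, simp)+

lemma ap_add: "ap T (\<phi> + \<psi>) = ap T \<phi> + ap T \<psi>"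
  using Rep_endo[of T] by simp

lemma ap_0: "ap T 0 = 0"
  using ap_add[of T 0 0] by simp

lemma continuous_on_endo_add [continuous_intros]:
  fixes f g :: "'a::topological_space \<Rightarrow> endo"
  assumes "continuous_on S f" "continuous_on S g"
  shows "continuous_on S (\<lambda>x. f x + g x)" "continuous_on S (\<lambda>x. f x - g x)"
  by (rule continuous_on_endoI, simp, intro continuous_on_add_circle continuous_on_diff_circle
      continuous_on_ap assms)+

lemma continuous_on_endo_sum [continuous_intros]:
  fixes f :: "'i \<Rightarrow> 'a::topological_space \<Rightarrow> endo"
  assumes "\<And>i. i \<in> A \<Longrightarrow> continuous_on S (f i)"
  shows "continuous_on S (\<lambda>x. \<Sum>i\<in>A. f i x)"
  using assms by (induction A rule: infinite_finite_induct) (simp_all add: continuous_on_endo_add)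

lemma continuous_on_endo_mult_right [continuous_intros]:
  fixes f :: "'a::topological_space \<Rightarrow> endo"
  assumes "continuous_on S f"
  shows "continuous_on S (\<lambda>x. f x * T)"
  by (rule continuous_on_endoI, simp, intro continuous_on_ap assms)

text \<open>Translating by a suffix makes \<open>wop\<close> multiplicative in the order of
  concatenation, and evaluating \<open>ap (wop w) \<phi>\<close> at the empty word returns \<phi>
  w.\<close>

lift_definition wop :: "bool list \<Rightarrow> endo" is "\<lambda>w \<phi> w'. \<phi> (w' @ w)"
  by (simp add: fun_eq_iff)

lemma ap_wop [simp]: "ap (wop w) \<phi> w' = \<phi> (w' @ w)"
  by transfer simp

lemma wop_append: "wop (w @ w') = wop w * wop w'"
  by transfer (simp add: fun_eq_iff)

lemma wop_Nil [simp]: "wop [] = 1"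
  by transfer (simp add: fun_eq_iff)

text \<open>A word operator on the left merely moves the word at which values are read. A general
  left factor would have to be continuous itself, so products of limits are always treated one
  factor at a time.\<close>

lemma continuous_on_wop_mult [continuous_intros]:
  fixes f :: "'a::topological_space \<Rightarrow> endo"
  assumes "continuous_on S f"
  shows "continuous_on S (\<lambda>x. wop w * f x)"
  by (rule continuous_on_endoI, simp, intro continuous_on_ap assms)

subsection \<open>Polynomial functions on words\<close>

fun wpoly :: "nat \<Rightarrow> (bool list \<Rightarrow> circle) set" where
  "wpoly 0 = {0}"
| "wpoly (Suc j) = {\<phi>. \<forall>y y'. length y = length y' \<longrightarrow> ap (wop y - wop y') \<phi> \<in> wpoly j}"

text \<open>\<open>wpoly j\<close> is degree below \<open>j\<close>.  The truncated difference makes the elements of \<open>filt j\<close>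
  vanish on \<open>wpoly m\<close> for all \<open>m \<le> j\<close>.\<close>

definition filt :: "nat \<Rightarrow> endo set" where
  "filt j = {T. \<forall>m. \<forall>\<phi>\<in>wpoly m. ap T \<phi> \<in> wpoly (m - j)}"

lemma wpoly_add: "\<phi> \<in> wpoly m \<Longrightarrow> \<psi> \<in> wpoly m \<Longrightarrow> \<phi> + \<psi> \<in> wpoly m"
proof (induction m arbitrary: \<phi> \<psi>)
  case (Suc m)
  then show ?case unfolding wpoly.simps mem_Collect_eq ap_add by blast
qed simp

lemma ap_uminus: "ap T (- \<phi>) = - ap T \<phi>"
  using ap_add[of T \<phi> "- \<phi>"] by (simp add: ap_0 eq_neg_iff_add_eq_0 add.commute)

lemma wpoly_uminus: "\<phi> \<in> wpoly m \<Longrightarrow> - \<phi> \<in> wpoly m"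
proof (induction m arbitrary: \<phi>)
  case (Suc m)
  then show ?case unfolding wpoly.simps mem_Collect_eq ap_uminus by blast
qed simp

lemma wpoly_0: "0 \<in> wpoly m"
proof (induction m)
  case (Suc m)
  then show ?case unfolding wpoly.simps mem_Collect_eq ap_0 by blast
qed (simp add: zero_fun_def)

lemma wpoly_wop: "\<phi> \<in> wpoly m \<Longrightarrow> ap (wop w) \<phi> \<in> wpoly m"
proof (cases m)
  case (Suc k)
  assume \<phi>: "\<phi> \<in> wpoly m"
  have "ap (wop y - wop y') (ap (wop w) \<phi>) = ap (wop (y @ w) - wop (y' @ w)) \<phi>" for y y'
    by (simp add: wop_append)
  then show ?thesis using \<phi> Suc by (simp del: ap_simps)
qed (simp add: ap_0)

lemma wpoly_Suc: "\<phi> \<in> wpoly m \<Longrightarrow> \<phi> \<in> wpoly (Suc m)"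
  using wpoly_add[OF wpoly_wop wpoly_uminus[OF wpoly_wop]] by simp

interpretation filt: filtered_ring filt
proof
  show "filt (Suc j) \<subseteq> filt j" for j
  proof
    fix T assume T: "T \<in> filt (Suc j)"
    have "\<psi> \<in> wpoly (m - Suc j) \<Longrightarrow> \<psi> \<in> wpoly (m - j)" for m \<psi>
      using wpoly_Suc[of \<psi> "m - Suc j"] by (cases "j < m") (auto simp: Suc_diff_Suc)
    then show "T \<in> filt j" using T unfolding filt_def by blast
  qed
  show "x * y \<in> filt (i + j)" if "x \<in> filt i" "y \<in> filt j" for x y i j
  proof -
    have "ap (x * y) \<phi> \<in> wpoly (m - (i + j))" if "\<phi> \<in> wpoly m" for m \<phi>
    proof -
      have "ap x (ap y \<phi>) \<in> wpoly (m - j - i)"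
        using that \<open>x \<in> filt i\<close> \<open>y \<in> filt j\<close> unfolding filt_def by blast
      then show ?thesis by (simp add: diff_diff_eq add.commute)
    qed
    then show ?thesis by (simp add: filt_def)
  qed
qed (auto simp: filt_def wpoly_0 wpoly_add wpoly_uminus)

lemma wop_filt: "wop w \<in> filt 0"
  by (simp add: filt_def wpoly_wop)

lemma wop_diff_filt: "length y = length y' \<Longrightarrow> wop y - wop y' \<in> filt 1"
proof -
  assume len: "length y = length y'"
  have "ap (wop y - wop y') \<phi> \<in> wpoly (m - 1)" if "\<phi> \<in> wpoly m" for m \<phi>
    using that len by (cases m) (auto simp: ap_0 simp del: ap_simps)
  then show ?thesis by (simp add: filt_def)
qed

text \<open>The statement is about an arbitrary family g so that the induction can replace g by its
  differences, which again have continuous coordinates.\<close>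

lemma closed_wpoly_vimage:
  fixes g :: "'a::topological_space \<Rightarrow> bool list \<Rightarrow> circle"
  assumes "\<And>w. continuous_on UNIV (\<lambda>x. g x w)"
  shows "closed {x. g x \<in> wpoly m}"
  using assms
proof (induction m arbitrary: g)
  case 0
  have "{x. g x \<in> wpoly 0} = (\<Inter>w. {x. g x w = 0})" by (auto simp: fun_eq_iff)
  then show ?case
    by (simp only:) (intro closed_INT ballI closed_Collect_eq 0 continuous_on_const)
next
  case (Suc m)
  have "{x. g x \<in> wpoly (Suc m)} =
    (\<Inter>(y, y')\<in>{(y, y'). length y = length y'}. {x. ap (wop y - wop y') (g x) \<in> wpoly m})" by auto
  moreover have "closed {x. ap (wop y - wop y') (g x) \<in> wpoly m}" for y y'
    by (rule Suc.IH) (simp, intro continuous_on_diff_circle Suc.prems)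
  ultimately show ?case by (simp add: closed_INT case_prod_unfold)
qed

lemma closed_filt: "closed (filt j)"
proof -
  have "filt j = (\<Inter>m. \<Inter>\<phi>\<in>wpoly m. {T. ap T \<phi> \<in> wpoly (m - j)})"
    by (auto simp: filt_def)
  moreover have "closed {T. ap T \<phi> \<in> wpoly m}" for \<phi> m
    by (rule closed_wpoly_vimage) (rule continuous_on_ap[OF continuous_on_id])
  ultimately show ?thesis by (simp add: closed_INT)
qed

section \<open>Simultaneous limits of families of operators\<close>

lemma compact_fun_imp_closed:
  fixes S :: "('i \<Rightarrow> 'a::t2_space) set"
  assumes "compact S" shows "closed S"
proof -
  have "Hausdorff_space (product_topology (\<lambda>_::'i. euclidean :: 'a topology) UNIV)"
  proof -
    have "Hausdorff_space (euclidean :: 'a topology)"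
      unfolding Hausdorff_space_def disjnt_def open_openin[symmetric]
      by (intro allI impI, elim conjE) (rule hausdorff)
    then show ?thesis unfolding Hausdorff_space_product_topology by blast
  qed
  then have "Hausdorff_space (euclidean :: ('i \<Rightarrow> 'a) topology)"
    by (simp only: euclidean_product_topology)
  then show ?thesis
    using compactin_imp_closedin[of euclidean S] assms by simp
qed

text \<open>Compactness of the source turns a limit of images into the image of a limit. It serves
  to extend a limit of two patterns to a simultaneous limit of all of them.\<close>

lemma closure_lift:
  fixes f :: "'a::topological_space \<Rightarrow> 'b::t2_space"
  assumes "compact (UNIV :: 'a set)" "continuous_on UNIV f" "y \<in> closure (f ` A)"
  obtains x where "x \<in> closure A" "f x = y"
proof -
  have "compact (UNIV \<inter> closure A)"
    using assms(1) by (rule compact_Int_closed) simp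
  then have "compact (f ` closure A)"
    using compact_continuous_image[OF continuous_on_subset[OF assms(2) subset_UNIV]] by simp
  then have "closed (f ` closure A)" by (rule compact_imp_closed)
  moreover have "f ` A \<subseteq> f ` closure A" using closure_subset by blast
  ultimately have "closure (f ` A) \<subseteq> f ` closure A" by (simp add: closure_minimal)
  then show ?thesis using assms(3) that by blast
qed

lemma compact_UNIV_prod:
  "compact (UNIV :: 'a::topological_space set) \<Longrightarrow> compact (UNIV :: 'b::topological_space set)
    \<Longrightarrow> compact (UNIV :: ('a \<times> 'b) set)"
  using compact_Times[of "UNIV :: 'a set" "UNIV :: 'b set"] by simp

lemma continuous_on_coordinate:
  fixes f :: "'a::topological_space \<Rightarrow> 'i \<Rightarrow> 'b::topological_space"
  shows "continuous_on S f \<Longrightarrow> continuous_on S (\<lambda>x. f x i)"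
  by (rule continuous_on_product_then_coordinatewise)

text \<open>The pairs of a map and a family of coefficients for it form a closed, hence compact,
  set; its projection to the maps is compact and therefore closed.\<close>

lemma closed_cube_poly: "closed {x :: 'q set \<Rightarrow> endo. filt.cube_poly x}"
proof -
  define Q where "Q = {z :: ('q set \<Rightarrow> endo) \<times> ('q set \<Rightarrow> endo).
     (\<forall>\<beta>. finite \<beta> \<longrightarrow> snd z \<beta> \<in> filt (card \<beta>)) \<and>
     (\<forall>\<sigma>. finite \<sigma> \<longrightarrow> fst z \<sigma> = (\<Sum>\<beta>\<in>Pow \<sigma>. snd z \<beta>))}"
  have Q: "Q = (\<Inter>\<beta>\<in>{\<beta>. finite \<beta>}. (\<lambda>z. snd z \<beta>) -` filt (card \<beta>)) \<inter>
     (\<Inter>\<sigma>\<in>{\<sigma>. finite \<sigma>}. {z. fst z \<sigma> = (\<Sum>\<beta>\<in>Pow \<sigma>. snd z \<beta>)})"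
    by (auto simp: Q_def)
  have cont: "continuous_on UNIV (\<lambda>z :: ('q set \<Rightarrow> endo) \<times> ('q set \<Rightarrow> endo). snd z \<beta>)"
    "continuous_on UNIV (\<lambda>z :: ('q set \<Rightarrow> endo) \<times> ('q set \<Rightarrow> endo). fst z \<beta>)" for \<beta>
    by (rule continuous_on_coordinate[OF continuous_on_snd[OF continuous_on_id]]
        continuous_on_coordinate[OF continuous_on_fst[OF continuous_on_id]])+
  have "closed ((\<lambda>z :: ('q set \<Rightarrow> endo) \<times> ('q set \<Rightarrow> endo). snd z \<beta>) -` filt (card \<beta>))" for \<beta>
    using cont(1) closed_filt by (simp add: continuous_on_closed_vimage)
  moreover have "closed {z :: ('q set \<Rightarrow> endo) \<times> ('q set \<Rightarrow> endo). fst z \<sigma> = (\<Sum>\<beta>\<in>Pow \<sigma>. snd z \<beta>)}" for \<sigma>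
    by (intro closed_Collect_eq continuous_on_endo_sum cont)
  ultimately have "closed Q"
    unfolding Q by (intro closed_Int closed_INT ballI)
  have "compact (UNIV \<inter> Q)"
    by (intro compact_Int_closed compact_UNIV_prod compact_UNIV_fun compact_UNIV_endo) fact
  then have "compact (fst ` Q)"
    using compact_continuous_image[OF continuous_on_fst[OF continuous_on_id]] by simp
  moreover have "fst ` Q = {x. filt.cube_poly x}"
  proof -
    have "fst ` Q = {x. \<exists>E. (x, E) \<in> Q}" by force
    then show ?thesis by (simp add: filt.cube_poly_def Q_def)
  qed
  ultimately show ?thesis by (simp add: compact_fun_imp_closed)
qed

subsection \<open>Periodic patterns and their limits\<close>

text \<open>\<open>True\<close> means take. The elements of \<sigma> name what is skipped, and
  positions carrying the same label are switched together.\<close>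

definition mask :: "'q list \<Rightarrow> 'q set \<Rightarrow> bool list" where
  "mask qs \<sigma> = map (\<lambda>q. q \<notin> \<sigma>) qs"

lemma cube_poly_mask: "filt.cube_poly (\<lambda>\<sigma>. wop (mask qs \<sigma>))"
proof (induction qs)
  case Nil
  then show ?case by (simp add: mask_def filt.cube_poly_const)
next
  case (Cons q qs)
  have "wop (mask (q # qs) \<sigma>) = (if q \<in> \<sigma> then wop [False] else wop [True]) * wop (mask qs \<sigma>)" for \<sigma>
    using wop_append[of "[q \<notin> \<sigma>]" "mask qs \<sigma>"] by (simp add: mask_def split: if_split)
  moreover have "filt.cube_poly (\<lambda>\<sigma>. if q \<in> \<sigma> then wop [False] else wop [True])"
    by (rule filt.cube_poly_letter[OF wop_filt wop_diff_filt]) simp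
  ultimately show ?case using filt.cube_poly_mult[OF _ Cons] by simp
qed

definition pat :: "nat \<Rightarrow> nat \<Rightarrow> nat set \<Rightarrow> bool list" where
  "pat d N = mask (map (\<lambda>i. i mod d) [0..<N])"

lemma pat_empty: "pat d N {} = replicate N True"
  by (simp add: pat_def mask_def comp_def map_replicate_const)

lemma pat_full: "d \<ge> 1 \<Longrightarrow> pat d N {..<d} = replicate N False"
  by (simp add: pat_def mask_def comp_def map_replicate_const)

lemma wop_replicate_add: "wop (replicate (m + n) x) = wop (replicate m x) * wop (replicate n x)"
  by (simp add: replicate_add wop_append)

text \<open>The idempotents belong to a limit of pairs with a common length N, so they can be the
  values at the two extreme sets of one polynomial family \<open>t\<close>. The companion
  \<open>t'\<close> is a limit along the same lengths and leaves room for the window.\<close>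

theorem pattern_limits:
  assumes d: "d \<ge> 1"
  obtains u v :: endo and t t' :: "nat set \<Rightarrow> endo"
  where "u * u = u" "v * v = v" "t {} = u" "t {..<d} = v"
    "t' {} * wop (replicate (d - 1) True) = u" "t' {..<d} * wop (replicate (d - 1) False) = v"
    "filt.cube_poly t" "filt.cube_poly t'"
    "\<And>\<tau>. t \<tau> \<in> closure (wop ` {pat d N \<tau> |N. N \<ge> 1})"
    "\<And>\<tau>. t' \<tau> \<in> closure (wop ` {pat d N \<tau> |N. N \<ge> 1})"
proof -
  define g where "g N = (wop (replicate N True), wop (replicate N False))" for N
  define m :: "endo \<times> endo \<Rightarrow> endo \<times> endo \<Rightarrow> endo \<times> endo"
    where "m x y = (fst x * fst y, snd x * snd y)" for x y
  let ?C = "closure (g ` {d..})"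
  have right: "continuous_on UNIV (\<lambda>x. m x y)" for y
    unfolding m_def
    by (intro continuous_on_Pair continuous_on_endo_mult_right continuous_on_fst continuous_on_snd continuous_on_id)
  have "\<exists>e\<in>?C. m e e = e"
  proof (rule ellis_numakura[where m = m])
    have "compact (UNIV \<inter> ?C)"
      by (intro compact_Int_closed compact_UNIV_prod compact_UNIV_endo) simp
    then show "compact ?C" by simp
    show "?C \<noteq> {}" by (simp add: closure_eq_empty)
    show "m x y \<in> ?C" if "x \<in> ?C" "y \<in> ?C" for x y
    proof (rule closure_mult[OF right _ _ that])
      show "continuous_on UNIV (m x)" if "x \<in> g ` {d..}" for x
        using that unfolding m_def g_def
        by (auto intro!: continuous_on_Pair continuous_on_wop_mult continuous_on_fst continuous_on_snd continuous_on_id)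
      show "m x y \<in> g ` {d..}" if xy: "x \<in> g ` {d..}" "y \<in> g ` {d..}" for x y
      proof -
        obtain N N' where "x = g N" "y = g N'" "N \<ge> d" using xy by auto
        then have "m x y = g (N + N')" by (simp add: m_def g_def wop_replicate_add)
        then show ?thesis using \<open>N \<ge> d\<close> by simp
      qed
    qed
    show "m (m x y) z = m x (m y z)" for x y z by (simp add: m_def mult.assoc)
  qed (rule right)
  then obtain e where e: "e \<in> ?C" "m e e = e" by blast
  obtain u v where "e = (u, v)" by (cases e)
  then have uv: "(u, v) \<in> ?C" "u * u = u" "v * v = v" using e by (simp_all add: m_def)
  \<comment> \<open>The second family is shorter by d - 1, so that a window of that length completes
    it to N letters. Starting at N = d keeps it non-empty and the subtraction exact.\<close>
  define P :: "nat \<Rightarrow> (nat set \<Rightarrow> endo) \<times> (nat set \<Rightarrow> endo)"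
    where "P N = (\<lambda>\<tau>. wop (pat d N \<tau>), \<lambda>\<tau>. wop (pat d (N - (d - 1)) \<tau>))" for N
  define f where "f z = (fst z {}, fst z {..<d})"
    for z :: "(nat set \<Rightarrow> endo) \<times> (nat set \<Rightarrow> endo)"
  have cf: "continuous_on UNIV (\<lambda>z :: (nat set \<Rightarrow> endo) \<times> (nat set \<Rightarrow> endo). fst z \<tau>)"
    and cs: "continuous_on UNIV (\<lambda>z :: (nat set \<Rightarrow> endo) \<times> (nat set \<Rightarrow> endo). snd z \<tau>)" for \<tau>
    by (rule continuous_on_coordinate[OF continuous_on_fst[OF continuous_on_id]]
        continuous_on_coordinate[OF continuous_on_snd[OF continuous_on_id]])+
  have "f (P N) = g N" for N
    using d by (simp add: f_def P_def g_def pat_empty pat_full)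
  then have "f ` P ` {d..} = g ` {d..}" by (simp add: image_image)
  then have "(u, v) \<in> closure (f ` P ` {d..})" using uv(1) by simp
  moreover have "continuous_on UNIV f"
    unfolding f_def by (intro continuous_on_Pair cf)
  ultimately obtain z where z: "z \<in> closure (P ` {d..})" "f z = (u, v)"
    using closure_lift[OF compact_UNIV_prod[OF compact_UNIV_fun compact_UNIV_fun],
        OF compact_UNIV_endo compact_UNIV_endo, of f "(u, v)" "P ` {d..}"] by blast
  have lim: "z \<in> K" if "closed K" "\<And>N. N \<ge> d \<Longrightarrow> P N \<in> K" for K
    using closure_minimal[of "P ` {d..}" K] that z(1) by blast
  show ?thesis
  proof (rule that[of u v "fst z" "snd z"])
    show "u * u = u" "v * v = v" by fact+
    show "fst z {} = u" "fst z {..<d} = v" using z(2) by (auto simp: f_def)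
    have "replicate (N - (d - 1)) x @ replicate (d - 1) x = replicate N x" if "N \<ge> d" for N and x :: bool
      using that by (simp flip: replicate_add)
    then have r: "wop (replicate (N - (d - Suc 0)) x) * wop (replicate (d - Suc 0) x) = wop (replicate N x)"
      if "N \<ge> d" for N x
      using that unfolding wop_append[symmetric] by simp
    have "z \<in> {z. snd z {} * wop (replicate (d - 1) True) = fst z {}}"
    proof (rule lim)
      show "closed {z :: (nat set \<Rightarrow> endo) \<times> (nat set \<Rightarrow> endo). snd z {} * wop (replicate (d - 1) True) = fst z {}}"
        by (intro closed_Collect_eq continuous_on_endo_mult_right cs cf)
    qed (simp add: P_def pat_empty r)
    then show "snd z {} * wop (replicate (d - 1) True) = u" using z(2) by (simp add: f_def)
    have "z \<in> {z. snd z {..<d} * wop (replicate (d - 1) False) = fst z {..<d}}"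
    proof (rule lim)
      show "closed {z :: (nat set \<Rightarrow> endo) \<times> (nat set \<Rightarrow> endo). snd z {..<d} * wop (replicate (d - 1) False) = fst z {..<d}}"
        by (intro closed_Collect_eq continuous_on_endo_mult_right cs cf)
    qed (simp add: P_def pat_full[OF d] r)
    then show "snd z {..<d} * wop (replicate (d - 1) False) = v" using z(2) by (simp add: f_def)
    have "closed (fst -` {x :: nat set \<Rightarrow> endo. filt.cube_poly x} :: ((nat set \<Rightarrow> endo) \<times> (nat set \<Rightarrow> endo)) set)"
      "closed (snd -` {x :: nat set \<Rightarrow> endo. filt.cube_poly x} :: ((nat set \<Rightarrow> endo) \<times> (nat set \<Rightarrow> endo)) set)"
      by (intro closed_vimage_fst closed_vimage_snd closed_cube_poly)+
    note cl = this
    have "P N \<in> fst -` {x. filt.cube_poly x}" "P N \<in> snd -` {x. filt.cube_poly x}" for N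
      unfolding vimage_eq mem_Collect_eq P_def fst_conv snd_conv pat_def by (rule cube_poly_mask)+
    then have "z \<in> fst -` {x. filt.cube_poly x}" "z \<in> snd -` {x. filt.cube_poly x}"
      using lim[OF cl(1)] lim[OF cl(2)] by blast+
    then show "filt.cube_poly (fst z)" "filt.cube_poly (snd z)" by simp_all
    show "fst z \<tau> \<in> closure (wop ` {pat d N \<tau> |N. N \<ge> 1})" for \<tau>
    proof -
      let ?F = "closure (wop ` {pat d N \<tau> |N. N \<ge> 1})"
      have "z \<in> (\<lambda>z. fst z \<tau>) -` ?F"
      proof (rule lim)
        show "closed ((\<lambda>z :: (nat set \<Rightarrow> endo) \<times> (nat set \<Rightarrow> endo). fst z \<tau>) -` ?F)"
          using cf by (simp add: continuous_on_closed_vimage)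
        show "P N \<in> (\<lambda>z. fst z \<tau>) -` ?F" if "N \<ge> d" for N
        proof -
          have "N \<ge> 1" using that d by simp
          then have "fst (P N) \<tau> \<in> wop ` {pat d N \<tau> |N. N \<ge> 1}"
            unfolding P_def fst_conv by blast
          then have "fst (P N) \<tau> \<in> ?F" by (rule subsetD[OF closure_subset])
          then show ?thesis by simp
        qed
      qed
      then show ?thesis by simp
    qed
    show "snd z \<tau> \<in> closure (wop ` {pat d N \<tau> |N. N \<ge> 1})" for \<tau>
    proof -
      let ?F = "closure (wop ` {pat d N \<tau> |N. N \<ge> 1})"
      have "z \<in> (\<lambda>z. snd z \<tau>) -` ?F"
      proof (rule lim)
        show "closed ((\<lambda>z :: (nat set \<Rightarrow> endo) \<times> (nat set \<Rightarrow> endo). snd z \<tau>) -` ?F)"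
          using cs by (simp add: continuous_on_closed_vimage)
        show "P N \<in> (\<lambda>z. snd z \<tau>) -` ?F" if "N \<ge> d" for N
        proof -
          have "N - (d - 1) \<ge> 1" using that d by simp
          then have "snd (P N) \<tau> \<in> wop ` {pat d N \<tau> |N. N \<ge> 1}"
            unfolding P_def snd_conv by blast
          then have "snd (P N) \<tau> \<in> ?F" by (rule subsetD[OF closure_subset])
          then show ?thesis by simp
        qed
      qed
      then show ?thesis by simp
    qed
  qed
qed

subsection \<open>Words with bounded gaps\<close>

text \<open>Gaps of at most d between taken positions allow d - 1 skips in a row, so the forbidden
  blocks have length d.\<close>

definition nogap :: "nat \<Rightarrow> bool list \<Rightarrow> bool" where
  "nogap d w \<longleftrightarrow> (\<forall>i. i + d \<le> length w \<longrightarrow> (\<exists>j<d. w ! (i + j)))"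

lemma nogap_append:
  assumes "nogap d w" "nogap d w'" "w \<noteq> [] \<and> last w \<or> w' \<noteq> [] \<and> hd w'"
  shows "nogap d (w @ w')"
  unfolding nogap_def
proof (intro allI impI)
  fix i assume i: "i + d \<le> length (w @ w')"
  consider "i + d \<le> length w" | "i \<ge> length w" | "i < length w" "length w < i + d" by linarith
  then show "\<exists>j<d. (w @ w') ! (i + j)"
  proof cases
    case 1
    then obtain j where "j < d" "w ! (i + j)" using assms(1) unfolding nogap_def by blast
    then show ?thesis using 1 by (auto simp: nth_append intro!: exI[of _ j])
  next
    case 2
    then have "i - length w + d \<le> length w'" using i by simp
    then obtain j where "j < d" "w' ! (i - length w + j)" using assms(2) unfolding nogap_def by blast
    then show ?thesis using 2 by (auto simp: nth_append intro!: exI[of _ j])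
  next
    case 3
    from assms(3) show ?thesis
    proof
      assume "w \<noteq> [] \<and> last w"
      then have "(w @ w') ! (i + (length w - 1 - i))"
        using 3 last_conv_nth[of w] by (simp add: nth_append)
      moreover have "length w - 1 - i < d" using 3 by simp
      ultimately show ?thesis by blast
    next
      assume "w' \<noteq> [] \<and> hd w'"
      then have "(w @ w') ! (i + (length w - i))"
        using 3 hd_conv_nth[of w'] by (simp add: nth_append)
      moreover have "length w - i < d" using 3 by simp
      ultimately show ?thesis by blast
    qed
  qed
qed

text \<open>Taken letters at both ends make these words closed under concatenation, and make the
  last letter the maximum of the resulting set.\<close>

definition gwords :: "nat \<Rightarrow> bool list set" where
  "gwords d = {w. w \<noteq> [] \<and> hd w \<and> last w \<and> nogap d w}"

lemma gwords_append: "w \<in> gwords d \<Longrightarrow> w' \<in> gwords d \<Longrightarrow> w @ w' \<in> gwords d"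
  unfolding gwords_def by (auto intro!: nogap_append)

lemma nogap_replicate: "d \<ge> 1 \<Longrightarrow> nogap d (replicate N True)"
  by (auto simp: nogap_def intro!: exI[of _ 0])

lemma gwords_sandwich:
  assumes "d \<ge> 1" "nogap d w" "N \<ge> 1" "M \<ge> 1"
  shows "replicate N True @ w @ replicate M True \<in> gwords d"
  unfolding gwords_def using assms
  by (auto intro!: nogap_append nogap_replicate simp: hd_append)

lemma replicate_gwords: "d \<ge> 1 \<Longrightarrow> N \<ge> 1 \<Longrightarrow> replicate N True \<in> gwords d"
  by (auto simp: gwords_def nogap_replicate)

section \<open>The compact semigroup of limits of admissible words and its unipotent group\<close>

abbreviation gops :: "nat \<Rightarrow> endo set" where
  "gops d \<equiv> closure (wop ` gwords d)"

lemma closure_wop_mult: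
  assumes "S \<in> closure (wop ` A)" "T \<in> closure (wop ` B)"
    and "\<And>w w'. w \<in> A \<Longrightarrow> w' \<in> B \<Longrightarrow> w @ w' \<in> K"
  shows "S * T \<in> closure (wop ` K)"
proof (rule closure_mult[OF _ _ _ assms(1,2)])
  show "continuous_on UNIV (\<lambda>t. t * s)" for s :: endo
    by (rule continuous_on_endo_mult_right[OF continuous_on_id])
  show "continuous_on UNIV ((*) t)" if "t \<in> wop ` A" for t
    using that by (auto intro: continuous_on_wop_mult[OF continuous_on_id])
  show "t * s \<in> wop ` K" if "t \<in> wop ` A" "s \<in> wop ` B" for t s
    using that assms(3) by (auto simp flip: wop_append)
qed

lemma closure_wop_filt: "T \<in> closure (wop ` A) \<Longrightarrow> T \<in> filt 0"
  using closure_minimal[of "wop ` A" "filt 0"] wop_filt closed_filt by auto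

lemma gops_mult: "S \<in> gops d \<Longrightarrow> T \<in> gops d \<Longrightarrow> S * T \<in> gops d"
  by (rule closure_wop_mult) (auto intro: gwords_append)

text \<open>The difference n = e - u satisfies n = - n n, so each membership in a filtration step
  improves to the next one.\<close>

lemma idempotent_cong:
  assumes "e * e = e" "u * u = u" "u * e = e" "e * u = e" "e - u \<in> filt 1"
  shows "e - u \<in> filt D"
proof -
  define n where "n = e - u"
  have sq: "n = - (n * n)" using assms by (simp add: n_def algebra_simps)
  have "n \<in> filt (Suc j)" for j
  proof (induction j)
    case 0
    then show ?case using assms(5) by (simp add: n_def)
  next
    case (Suc j)
    have "n * n \<in> filt (1 + Suc j)" using filt.mult_mem assms(5) Suc unfolding n_def by blast
    then show ?case using filt.uminus_mem sq by fastforce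
  qed
  then show ?thesis using filt.Suc_subset unfolding n_def by blast
qed

text \<open>The limits congruent to u form a compact semigroup A, and A z contains an idempotent T
  z. Multiplied by u from the left, it remains idempotent, has u as a two-sided identity and is
  congruent to u, hence equals u modulo \<open>filt D\<close>. So u T u is a left inverse of
  z.\<close>

lemma gops_left_inverse:
  assumes u: "u \<in> gops d" "u * u = u" and z: "z \<in> gops d" "z - u \<in> filt 1" "u * z = z" "z * u = z"
  obtains z' where "z' \<in> gops d" "z' - u \<in> filt 1" "u * z' = z'" "z' * u = z'" "z' * z - u \<in> filt D"
proof -
  define A where "A = {T \<in> gops d. T - u \<in> filt 1}"
  have fu: "u \<in> filt 0" using u closure_wop_filt by blast
  have A0: "T \<in> filt 0" if "T \<in> A" for T using that closure_wop_filt by (auto simp: A_def)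
  have Amult: "S * T \<in> A" if "S \<in> A" "T \<in> A" for S T
    using gops_mult[of S d T] filt.cong_mult[of S u 1 T u] that fu A0 u(2) by (auto simp: A_def)
  have zA: "z \<in> A" using z by (simp add: A_def)
  let ?C = "(\<lambda>T. T * z) ` A"
  have "\<exists>e\<in>?C. e * e = e"
  proof (rule ellis_numakura[where m = "(*)"])
    have "continuous_on UNIV (\<lambda>T. T - u)"
      by (intro continuous_on_endo_add continuous_on_id continuous_on_const)
    then have "closed ((\<lambda>T. T - u) -` filt 1)"
      using closed_filt by (simp add: continuous_on_closed_vimage)
    then have "closed A" unfolding A_def by (simp add: closed_Int vimage_def Collect_conj_eq)
    then have "compact (UNIV \<inter> A)" by (rule compact_Int_closed[OF compact_UNIV_endo])
    then show "compact ?C"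
      using compact_continuous_image[OF continuous_on_endo_mult_right[OF continuous_on_id]] by simp
    show "?C \<noteq> {}" using zA by blast
    show "x * y \<in> ?C" if "x \<in> ?C" "y \<in> ?C" for x y
    proof -
      obtain S T where "x = S * z" "y = T * z" "S \<in> A" "T \<in> A" using \<open>x \<in> ?C\<close> \<open>y \<in> ?C\<close> by blast
      then have "x * y = ((S * z) * T) * z" "(S * z) * T \<in> A" using Amult zA by (auto simp: mult.assoc)
      then show ?thesis by blast
    qed
    show "continuous_on UNIV (\<lambda>x. x * y)" for y :: endo
      by (rule continuous_on_endo_mult_right[OF continuous_on_id])
  qed (simp add: mult.assoc)
  then obtain T where T: "T \<in> A" "T * z * (T * z) = T * z" by blast
  have uA: "u \<in> A" using u by (simp add: A_def)
  define z' where "z' = u * T * u"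
  have z'A: "z' \<in> A" unfolding z'_def using Amult uA T by blast
  have z'z: "z' * z = u * (T * z)" unfolding z'_def by (simp add: mult.assoc z)
  have eu: "(T * z) * u = T * z" by (simp add: mult.assoc z)
  have "z' * z - u \<in> filt D" unfolding z'z
  proof (rule idempotent_cong[OF _ u(2)])
    have "u * (T * z) * (u * (T * z)) = u * (((T * z) * u) * (T * z))" by (simp add: mult.assoc)
    then show "u * (T * z) * (u * (T * z)) = u * (T * z)" unfolding eu T(2) .
    show "u * (u * (T * z)) = u * (T * z)" by (simp add: u(2) flip: mult.assoc)
    show "u * (T * z) * u = u * (T * z)" by (simp add: mult.assoc z)
    show "u * (T * z) - u \<in> filt 1" using Amult[OF uA Amult[OF T(1) zA]] by (simp add: A_def)
  qed
  moreover have "u * z' = z'" "z' * u = z'"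
    by (simp_all add: z'_def u(2) mult.assoc) (simp add: u(2) flip: mult.assoc)
  ultimately show ?thesis using that z'A by (auto simp: A_def)
qed

text \<open>The group lives in the corner of u, whose identity is u. Adding 1 - u carries it into
  the whole ring with identity 1, where the results on 1 + \<open>filt 1\<close> apply.\<close>

lemma ugroup_gops:
  assumes u: "u \<in> gops d" "u * u = u" and D: "D \<ge> 1"
  shows "filt.ugroup D {T. \<exists>z\<in>gops d. z - u \<in> filt 1 \<and> u * z = z \<and> z * u = z \<and> T - (1 - u + z) \<in> filt D}"
    (is "filt.ugroup D ?H")
proof -
  have fu: "u \<in> filt 0" using u closure_wop_filt by blast
  have f1: "1 - u + z \<in> filt 0" if "z \<in> gops d" for z
    using filt.add_mem[OF filt.diff_mem[OF filt.one_mem fu] closure_wop_filt[OF that]] .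
  have H0: "T \<in> filt 0" if "T - (1 - u + z) \<in> filt D" "z \<in> gops d" for T z
    using filt.add_mem[OF filt.antimono_mem[OF that(1), of 0] f1[OF that(2)]] by simp
  have prod: "(1 - u + z) * (1 - u + z') = 1 - u + z * z'" if "z * u = z" "u * z' = z'" for z z'
    using that u(2) by (simp add: algebra_simps)
  have mem: "T \<in> ?H" if "z \<in> gops d" "z - u \<in> filt 1" "u * z = z" "z * u = z" "T - (1 - u + z) \<in> filt D" for T z
    using that by blast
  show ?thesis
    unfolding filt.ugroup_def
  proof (intro conjI ballI allI impI)
    show "1 \<in> ?H" using u by (intro mem[of u]) simp_all
  next
    fix c assume "c \<in> ?H"
    then obtain z where z: "z \<in> gops d" "z - u \<in> filt 1" "u * z = z" "z * u = z"
      and c: "c - (1 - u + z) \<in> filt D" by blast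
    show "c - 1 \<in> filt 1"
      using filt.add_mem[OF filt.antimono_mem[OF c D] z(2)] by simp
    show "c' \<in> ?H" if "c' - c \<in> filt D" for c'
      using mem[OF z] filt.cong_trans[OF that c] by blast
    show "\<exists>c'\<in>?H. c' * c - 1 \<in> filt D"
    proof -
      obtain z' where z': "z' \<in> gops d" "z' - u \<in> filt 1" "u * z' = z'" "z' * u = z'" "z' * z - u \<in> filt D"
        using gops_left_inverse[OF u z] by blast
      have "(1 - u + z') * c - (1 - u + z') * (1 - u + z) \<in> filt D"
        using filt.mult_mem_left[OF f1[OF z'(1)] c] by (simp add: right_diff_distrib)
      moreover have "(1 - u + z') * (1 - u + z) - 1 \<in> filt D"
        using z'(5) prod[OF z'(4) z(3)] by simp
      ultimately have "(1 - u + z') * c - 1 \<in> filt D" by (rule filt.cong_trans)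
      moreover have "1 - u + z' \<in> ?H" using z' by (intro mem[of z']) simp_all
      ultimately show ?thesis by blast
    qed
    fix c' assume "c' \<in> ?H"
    then obtain z' where z': "z' \<in> gops d" "z' - u \<in> filt 1" "u * z' = z'" "z' * u = z'"
      and c': "c' - (1 - u + z') \<in> filt D" by blast
    show "c * c' \<in> ?H"
    proof (rule mem[of "z * z'"])
      show "z * z' \<in> gops d" by (rule gops_mult[OF z(1) z'(1)])
      show "z * z' - u \<in> filt 1"
        using filt.cong_mult[OF z(2) z'(2) closure_wop_filt[OF z'(1)] fu] u(2) by simp
      show "u * (z * z') = z * z'" by (simp add: z flip: mult.assoc)
      show "z * z' * u = z * z'" by (simp add: z' mult.assoc)
      show "c * c' - (1 - u + z * z') \<in> filt D"
        using filt.cong_mult[OF c c' H0[OF c' z'(1)] f1[OF z(1)]] prod[OF z(4) z'(3)] by simp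
    qed
  qed
qed

section \<open>A window between two periodic stretches, and the words obtained by skipping
  pieces\<close>

datatype piece = Lp nat | Mp nat | Rp nat

lemma inj_piece: "inj Lp" "inj Mp" "inj Rp"
  by (auto intro: injI)

lemma mod_window_inj:
  fixes m m' d i :: nat
  assumes "m mod d = m' mod d" "i \<le> m" "m < i + d" "i \<le> m'" "m' < i + d"
  shows "m = m'"
proof -
  have "a = b" if "a \<le> b" "a mod d = b mod d" "i \<le> a" "b < i + d" for a b
  proof -
    have "d dvd b - a" using that(1,2) by (metis mod_eq_dvd_iff_nat)
    moreover have "b - a < d" using that by linarith
    ultimately have "b - a = 0" by (metis nat_dvd_not_less neq0_conv)
    then show ?thesis using that by simp
  qed
  from this[of m m'] this[of m' m] show ?thesis using assms by linarith
qed

lemma mask_disjoint: "set qs \<inter> \<sigma> = {} \<Longrightarrow> mask qs \<sigma> = replicate (length qs) True"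
  by (induction qs) (auto simp: mask_def)

lemma mask_subset: "set qs \<subseteq> \<sigma> \<Longrightarrow> mask qs \<sigma> = replicate (length qs) False"
  by (induction qs) (auto simp: mask_def)

text \<open>A window of length \<open>d\<close> misses the pieces \<open>Rp\<close> or the pieces \<open>Lp\<close>, since there are
  \<open>d - 1\<close> positions in between, and it consists of \<open>d\<close> different pieces.\<close>

lemma nogap_mask:
  assumes d: "d \<ge> 1" and fin: "finite \<gamma>"
    and A: "card (\<gamma> \<inter> (Lp ` {..<d} \<union> Mp ` {..<d-1})) < d"
    and B: "card (\<gamma> \<inter> (Mp ` {..<d-1} \<union> Rp ` {..<d})) < d"
  shows "nogap d (pat d N (Lp -` \<gamma>) @ mask (map Mp [0..<d-1]) \<gamma> @ pat d M (Rp -` \<gamma>))"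
proof -
  define qs where "qs = map (\<lambda>i. Lp (i mod d)) [0..<N] @ map Mp [0..<d-1] @ map (\<lambda>i. Rp (i mod d)) [0..<M]"
  have qs: "pat d N (Lp -` \<gamma>) @ mask (map Mp [0..<d-1]) \<gamma> @ pat d M (Rp -` \<gamma>) = mask qs \<gamma>"
    by (simp add: qs_def pat_def mask_def comp_def)
  have nth: "qs ! m = (if m < N then Lp (m mod d) else if m < N + (d - 1) then Mp (m - N)
      else Rp ((m - N - (d - 1)) mod d))" if "m < length qs" for m
    using that by (auto simp: qs_def nth_append)
  have "\<exists>j<d. qs ! (i + j) \<notin> \<gamma>" if i: "i + d \<le> length qs" for i
  proof (rule ccontr)
    assume *: "\<not> (\<exists>j<d. qs ! (i + j) \<notin> \<gamma>)"
    have sub: "qs ! m \<in> \<gamma>" if "m \<in> {i..<i + d}" for m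
    proof -
      have "m - i < d" "i + (m - i) = m" using that by auto
      then show ?thesis using * by metis
    qed
    have bad: False if "(!) qs ` {i..<i + d} \<subseteq> S" "inj_on ((!) qs) {i..<i + d}" "card (\<gamma> \<inter> S) < d" for S
    proof -
      have "d = card ((!) qs ` {i..<i + d})" using card_image[OF that(2)] by simp
      also have "\<dots> \<le> card (\<gamma> \<inter> S)"
        using fin that(1) sub by (intro card_mono) auto
      finally show False using that(3) by simp
    qed
    show False
    proof (cases "i + d \<le> N + (d - 1)")
      case True
      have nth': "qs ! m = (if m < N then Lp (m mod d) else Mp (m - N))" if "m \<in> {i..<i + d}" for m
        using nth[of m] that i True by auto
      show False
      proof (rule bad[OF _ _ A])
        show "(!) qs ` {i..<i + d} \<subseteq> Lp ` {..<d} \<union> Mp ` {..<d-1}"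
          using d True by (auto simp: nth' split: if_splits)
        show "inj_on ((!) qs) {i..<i + d}"
        proof (rule inj_onI)
          fix m m' assume m: "m \<in> {i..<i + d}" "m' \<in> {i..<i + d}" "qs ! m = qs ! m'"
          have e: "(if m < N then Lp (m mod d) else Mp (m - N)) = (if m' < N then Lp (m' mod d) else Mp (m' - N))"
            using m(3) unfolding nth'[OF m(1)] nth'[OF m(2)] .
          show "m = m'"
          proof (cases "m < N")
            case True
            then have "m mod d = m' mod d" using e by (simp split: if_splits)
            then show ?thesis using m(1,2) by (intro mod_window_inj[of m d m' i]) simp_all
          next
            case False
            then have "m - N = m' - N" "\<not> m' < N" using e by (simp_all split: if_splits)
            then show ?thesis using False by linarith
          qed
        qed
      qed
    next
      case False
      then have iN: "i \<ge> N" using d by linarith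
      have nth': "qs ! m = (if m < N + (d - 1) then Mp (m - N) else Rp ((m - N - (d - 1)) mod d))"
        if "m \<in> {i..<i + d}" for m
        using nth[of m] that i iN by auto
      show False
      proof (rule bad[OF _ _ B])
        show "(!) qs ` {i..<i + d} \<subseteq> Mp ` {..<d-1} \<union> Rp ` {..<d}"
          using d iN by (auto simp: nth' split: if_splits)
        show "inj_on ((!) qs) {i..<i + d}"
        proof (rule inj_onI)
          fix m m' assume m: "m \<in> {i..<i + d}" "m' \<in> {i..<i + d}" "qs ! m = qs ! m'"
          have e: "(if m < N + (d - 1) then Mp (m - N) else Rp ((m - N - (d - 1)) mod d))
            = (if m' < N + (d - 1) then Mp (m' - N) else Rp ((m' - N - (d - 1)) mod d))"
            using m(3) unfolding nth'[OF m(1)] nth'[OF m(2)] .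
          show "m = m'"
          proof (cases "m < N + (d - 1)")
            case True
            then have "m - N = m' - N" using e by (simp split: if_splits)
            moreover have "N \<le> m" "N \<le> m'" using m(1,2) iN by simp_all
            ultimately show ?thesis by linarith
          next
            case False
            then have m': "\<not> m' < N + (d - 1)"
              and eq: "(m - N - (d - 1)) mod d = (m' - N - (d - 1)) mod d"
              using e by (simp_all split: if_splits)
            have "m - N - (d - 1) = m' - N - (d - 1)"
            proof (rule mod_window_inj[OF eq, of "i - N - (d - 1)"])
              have "i \<le> m" "m < i + d" "i \<le> m'" "m' < i + d" using m(1,2) by simp_all
              then show "i - N - (d - 1) \<le> m - N - (d - 1)" "m - N - (d - 1) < i - N - (d - 1) + d"
                "i - N - (d - 1) \<le> m' - N - (d - 1)" "m' - N - (d - 1) < i - N - (d - 1) + d"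
                using False m' by linarith+
            qed
            then show ?thesis using False m' by linarith
          qed
        qed
      qed
    qed
  qed
  moreover have "mask qs \<gamma> ! (i + j) \<longleftrightarrow> qs ! (i + j) \<notin> \<gamma>" if "i + d \<le> length qs" "j < d" for i j
    using that by (simp add: mask_def)
  moreover have "length (mask qs \<gamma>) = length qs" by (simp add: mask_def)
  ultimately show ?thesis unfolding qs nogap_def by metis
qed

text \<open>The step \<open>Suc d\<close> is the one that annihilates \<open>wpoly (Suc d)\<close>,
  so k and v act identically on functions of degree at most d.\<close>

theorem unipotent_limit:
  assumes d: "d \<ge> 1"
  obtains k v where "v \<in> closure (wop ` {replicate N False |N. True})"
    "k \<in> closure (wop ` {replicate N False @ w @ replicate M False |N w M. w \<in> gwords d})"
    "k - v \<in> filt (Suc d)"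
proof -
  obtain u v :: endo and t t' :: "nat set \<Rightarrow> endo"
    where uv: "u * u = u" "v * v = v" and t: "t {} = u" "t {..<d} = v"
    and t': "t' {} * wop (replicate (d - 1) True) = u" "t' {..<d} * wop (replicate (d - 1) False) = v"
    and poly: "filt.cube_poly t" "filt.cube_poly t'"
    and cl: "\<And>\<tau>. t \<tau> \<in> closure (wop ` {pat d N \<tau> |N. N \<ge> 1})"
      "\<And>\<tau>. t' \<tau> \<in> closure (wop ` {pat d N \<tau> |N. N \<ge> 1})"
    by (rule pattern_limits[OF d]) (rule that, assumption+)
  have u: "u \<in> closure (wop ` {replicate N True |N. N \<ge> 1})"
    using cl(1)[of "{}"] by (simp add: t pat_empty)
  have v: "v \<in> closure (wop ` {replicate N False |N. N \<ge> 1})"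
    using cl(1)[of "{..<d}"] by (simp add: t pat_full[OF d])
  have "wop ` {replicate N True |N. N \<ge> 1} \<subseteq> wop ` gwords d"
    using replicate_gwords[OF d] by blast
  then have ug: "u \<in> gops d" using u closure_mono by blast
  have fu: "u \<in> filt 0" "v \<in> filt 0" using u v closure_wop_filt by blast+
  define mid where "mid \<sigma> = mask (map Mp [0..<d-1]) \<sigma>" for \<sigma>
  \<comment> \<open>The outer factors u put all values into the corner of u, and they supply the
    taken letters at both ends that \<open>gwords\<close> demands.\<close>
  define x where "x \<sigma> = u * (t' (Lp -` \<sigma>) * (wop (mid \<sigma>) * (t (Rp -` \<sigma>) * u)))" for \<sigma>
  have xpoly: "filt.cube_poly x"
    unfolding x_def mid_def
    by (intro filt.cube_poly_mult filt.cube_poly_const filt.cube_poly_vimage cube_poly_mask poly inj_piece fu)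
  define A where "A = Lp ` {..<d} \<union> Mp ` {..<d-1}"
  define B where "B = Mp ` {..<d-1} \<union> Rp ` {..<d}"
  have fin: "finite A" "finite B" by (auto simp: A_def B_def)
  have vim: "Lp -` A = {..<d}" "Rp -` A = {}" "Lp -` B = {}" "Rp -` B = {..<d}"
    "Lp -` (A \<union> B) = {..<d}" "Rp -` (A \<union> B) = {..<d}" "Lp -` (A \<inter> B) = {}" "Rp -` (A \<inter> B) = {}"
    by (auto simp: A_def B_def)
  have mid_full: "mid \<sigma> = replicate (d - 1) False" if "Mp ` {..<d-1} \<subseteq> \<sigma>" for \<sigma>
    using mask_subset[of "map Mp [0..<d-1]" \<sigma>] that by (simp add: mid_def lessThan_atLeast0)
  have midA: "mid A = replicate (d - 1) False" and midB: "mid B = replicate (d - 1) False"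
    and midAB: "mid (A \<union> B) = replicate (d - 1) False"
    by (rule mid_full; auto simp: A_def B_def)+
  have mid_empty: "mid {} = replicate (d - 1) True"
    using mask_disjoint[of "map Mp [0..<d-1]" "{}"] by (simp add: mid_def)
  have uu: "u * (u * T) = u * T" "v * (v * T) = v * T" for T
    by (simp_all add: uv flip: mult.assoc)
  have x0: "x {} = u"
  proof -
    have "x {} = u * ((t' {} * wop (replicate (d - 1) True)) * (u * u))"
      unfolding x_def vimage_empty t mid_empty by (simp only: mult.assoc)
    then show ?thesis unfolding t' uv .
  qed
  have xA: "x A = u * (v * u)"
  proof -
    have "x A = u * ((t' {..<d} * wop (replicate (d - 1) False)) * (u * u))"
      unfolding x_def vim t midA by (simp only: mult.assoc)
    then show ?thesis unfolding t' uv .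
  qed
  have xAB: "x (A \<union> B) = u * (v * u)"
  proof -
    have "x (A \<union> B) = u * ((t' {..<d} * wop (replicate (d - 1) False)) * (v * u))"
      unfolding x_def vim t midAB by (simp only: mult.assoc)
    then show ?thesis unfolding t' uu .
  qed
  define y where "y = t' {} * wop (replicate (d - 1) False)"
  have xB: "x B = u * (y * (v * u))"
    unfolding x_def vim t midB y_def by (simp only: mult.assoc)
  have adm: "x \<gamma> \<in> gops d" if "finite \<gamma>" "card (\<gamma> \<inter> A) < d" "card (\<gamma> \<inter> B) < d" for \<gamma>
  proof -
    have 1: "t (Rp -` \<gamma>) * u \<in> closure (wop ` {pat d N (Rp -` \<gamma>) @ replicate M True |N M. M \<ge> 1})"
      by (rule closure_wop_mult[OF cl(1) u]) auto
    have mem: "wop (mid \<gamma>) \<in> closure (wop ` {mid \<gamma>})"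
      by (rule subsetD[OF closure_subset]) simp
    have 2: "wop (mid \<gamma>) * (t (Rp -` \<gamma>) * u)
      \<in> closure (wop ` {mid \<gamma> @ pat d N (Rp -` \<gamma>) @ replicate M True |N M. M \<ge> 1})"
      by (rule closure_wop_mult[OF mem 1]) auto
    have 3: "t' (Lp -` \<gamma>) * (wop (mid \<gamma>) * (t (Rp -` \<gamma>) * u)) \<in> closure (wop ` {pat d N' (Lp -` \<gamma>) @
        mid \<gamma> @ pat d N (Rp -` \<gamma>) @ replicate M True |N' N M. M \<ge> 1})"
      by (rule closure_wop_mult[OF cl(2) 2]) auto
    show ?thesis unfolding x_def
    proof (rule closure_wop_mult[OF u 3])
      fix w w' assume "w \<in> {replicate N True |N. N \<ge> 1}"
        "w' \<in> {pat d N' (Lp -` \<gamma>) @ mid \<gamma> @ pat d N (Rp -` \<gamma>) @ replicate M True |N' N M. M \<ge> 1}"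
      then obtain N0 N' N M where "w = replicate N0 True" "N0 \<ge> 1" "M \<ge> 1"
        "w' = (pat d N' (Lp -` \<gamma>) @ mid \<gamma> @ pat d N (Rp -` \<gamma>)) @ replicate M True"
        by auto
      then show "w @ w' \<in> gwords d"
        using gwords_sandwich[OF d nogap_mask[OF d that[unfolded A_def B_def]], of N0 M N' N]
        by (simp add: mid_def)
    qed
  qed
  have ux: "u * x \<sigma> = x \<sigma>" "x \<sigma> * u = x \<sigma>" for \<sigma>
    by (simp_all add: x_def uu uv mult.assoc)
  have x1: "x \<sigma> - u \<in> filt 1" if "finite \<sigma>" for \<sigma>
    using filt.cube_poly_diff_empty_mem[OF xpoly that] by (simp add: x0)
  let ?H = "{T. \<exists>z\<in>gops d. z - u \<in> filt 1 \<and> u * z = z \<and> z * u = z \<and> T - (1 - u + z) \<in> filt (Suc d)}"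
  have H: "filt.ugroup (Suc d) ?H" by (rule ugroup_gops[OF ug uv(1)]) simp
  have admH: "1 - u + x \<gamma> \<in> ?H" if "finite \<gamma>" "card (\<gamma> \<inter> A) < d" "card (\<gamma> \<inter> B) < d" for \<gamma>
    using adm[OF that] x1[OF that(1)] ux by (intro CollectI bexI[of _ "x \<gamma>"]) simp_all
  have "1 - u + x B \<in> ?H"
  proof (rule filt.cube_straddle[OF H _ fin])
    show "filt.cube_poly (\<lambda>\<sigma>. 1 - u + x \<sigma>)"
      by (intro filt.cube_poly_add filt.cube_poly_const xpoly filt.diff_mem filt.one_mem fu)
    show "1 - u + x {} = 1" by (simp add: x0)
    show "1 - u + x A = 1 - u + x (A \<union> B)" by (simp add: xA xAB)
    have "A \<inter> B = Mp ` {..<d-1}" by (auto simp: A_def B_def)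
    moreover have "card (Mp ` {..<d-1}) < d" using d card_image_le[of "{..<d-1}" Mp] by simp
    ultimately have "card (A \<inter> B) < d" by simp
    then show "1 - u + x (A \<inter> B) \<in> ?H"
    proof (intro admH)
      have "A \<inter> B \<inter> A = A \<inter> B" "A \<inter> B \<inter> B = A \<inter> B" by blast+
      then show "card (A \<inter> B \<inter> A) < d" "card (A \<inter> B \<inter> B) < d"
        using \<open>card (A \<inter> B) < d\<close> by simp_all
    qed (use fin in simp)
    show "1 - u + x \<gamma> \<in> ?H"
      if \<beta>: "\<beta> \<subseteq> A \<union> B" "\<not> \<beta> \<subseteq> A" "\<not> \<beta> \<subseteq> B" "card \<beta> < Suc d" "\<gamma> \<subseteq> \<beta>" for \<beta> \<gamma>
    proof -
      have fb: "finite \<beta>" by (rule finite_subset[OF \<beta>(1)]) (use fin in simp)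
      have f\<gamma>: "finite \<gamma>" by (rule finite_subset[OF \<beta>(5) fb])
      \<comment> \<open>A straddling \<beta> contains both an \<open>Lp\<close> and an
        \<open>Rp\<close>. Discarding either kind leaves fewer than d of its at most d
        pieces.\<close>
      have "\<beta> \<inter> A \<subset> \<beta>" "\<beta> \<inter> B \<subset> \<beta>" using \<beta>(2,3) by auto
      from this[THEN psubset_card_mono[OF fb]]
      have "card (\<beta> \<inter> A) < d" "card (\<beta> \<inter> B) < d" using \<beta>(4) by linarith+
      moreover have "card (\<gamma> \<inter> A) \<le> card (\<beta> \<inter> A)" "card (\<gamma> \<inter> B) \<le> card (\<beta> \<inter> B)"
        by (rule card_mono; use fb \<beta>(5) in auto)+
      ultimately have "card (\<gamma> \<inter> A) < d" "card (\<gamma> \<inter> B) < d" by linarith+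
      then show ?thesis by (rule admH[OF f\<gamma>])
    qed
  qed simp
  then obtain z where z: "z \<in> gops d" "z - u \<in> filt 1" "u * z = z" "z * u = z"
    "1 - u + x B - (1 - u + z) \<in> filt (Suc d)" by blast
  obtain z' where z': "z' \<in> gops d" "z' - u \<in> filt 1" "u * z' = z'" "z' * u = z'" "z' * z - u \<in> filt (Suc d)"
    by (rule gops_left_inverse[OF ug uv(1) z(1-4), of "Suc d"])
  have "z' * (x B - z) \<in> filt (Suc d)"
    using z(5) by (intro filt.mult_mem_left closure_wop_filt[OF z'(1)]) simp
  from filt.add_mem[OF this z'(5)] have "z' * x B - u \<in> filt (Suc d)"
    by (simp add: algebra_simps)
  moreover have "z' * x B = z' * (y * (v * u))"
    unfolding xB by (simp add: z'(4) flip: mult.assoc)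
  ultimately have zy: "z' * (y * (v * u)) - u \<in> filt (Suc d)" by simp
  \<comment> \<open>Multiplying the congruence \<open>zy\<close> by v on both sides moves skips to
    both ends of the words. It says that k (v u v) is congruent to v u v, so v u v remains to be
    cancelled.\<close>
  define k where "k = v * (z' * (y * v))"
  define n where "n = v * (u * v) - v"
  have kv: "k * v = k" by (simp add: k_def mult.assoc uv)
  have n1: "n \<in> filt 1"
  proof -
    have "u - v \<in> filt 1"
      using filt.cube_poly_diff_empty_mem[OF poly(1), of "{..<d}"] filt.cong_sym by (simp add: t)
    then have "v * ((u - v) * v) \<in> filt 1"
      by (intro filt.mult_mem_left filt.mult_mem_right fu)
    then show ?thesis by (simp add: n_def algebra_simps uv)
  qed
  have "v * ((z' * (y * (v * u)) - u) * v) \<in> filt (Suc d)"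
    by (intro filt.mult_mem_left filt.mult_mem_right fu zy)
  \<comment> \<open>Since (k - v) (1 - v) = 0, the factor 1 + n = (1 - v) + v u v acts on k - v like
    v u v. It is moreover unipotent, because u and v agree modulo \<open>filt 1\<close>, and can be
    inverted by \<open>uinv\<close>.\<close>
  moreover have "(k - v) * (1 + n) = v * ((z' * (y * (v * u)) - u) * v)"
    by (simp add: n_def k_def algebra_simps uv uu)
  ultimately have kn: "(k - v) * (1 + n) \<in> filt (Suc d)" by simp
  have y: "y \<in> closure (wop ` {replicate N True @ replicate M False |N M. N \<ge> 1})"
    unfolding y_def
  proof (rule closure_wop_mult)
    show "t' {} \<in> closure (wop ` {replicate N True |N. N \<ge> 1})"
      using cl(2)[of "{}"] by (simp add: pat_empty)
    show "wop (replicate (d - 1) False) \<in> closure (wop ` {replicate (d - 1) False})"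
      by (rule subsetD[OF closure_subset]) simp
  qed blast
  have yv: "y * v \<in> closure (wop ` {replicate N True @ replicate M False |N M. N \<ge> 1})"
  proof (rule closure_wop_mult[OF y v])
    fix w w' assume "w \<in> {replicate N True @ replicate M False |N M. N \<ge> 1}" "w' \<in> {replicate N False |N. N \<ge> 1}"
    then obtain N M M' where "w @ w' = replicate N True @ replicate (M + M') False" "N \<ge> 1"
      by (auto simp: replicate_add)
    then show "w @ w' \<in> {replicate N True @ replicate M False |N M. N \<ge> 1}" by blast
  qed
  have zyv: "z' * (y * v) \<in> closure (wop ` {w @ replicate M False |w M. w \<in> gwords d})"
  proof (rule closure_wop_mult[OF z'(1) yv])
    fix w w' assume "w \<in> gwords d" "w' \<in> {replicate N True @ replicate M False |N M. N \<ge> 1}"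
    then obtain N M where "w @ w' = (w @ replicate N True) @ replicate M False" "N \<ge> 1" by auto
    moreover have "w @ replicate N True \<in> gwords d"
      by (rule gwords_append[OF \<open>w \<in> gwords d\<close> replicate_gwords[OF d]]) fact
    ultimately show "w @ w' \<in> {w @ replicate M False |w M. w \<in> gwords d}" by blast
  qed
  have "k \<in> closure (wop ` {replicate N False @ w @ replicate M False |N w M. w \<in> gwords d})"
    unfolding k_def by (rule closure_wop_mult[OF v zyv]) blast
  moreover have "v \<in> closure (wop ` {replicate N False |N. True})"
    using cl(1)[of "{..<d}"] closure_mono[of "wop ` {replicate N False |N. N \<ge> 1}" "wop ` {replicate N False |N. True}"]
    by (auto simp: t pat_full[OF d])
  moreover have "k - v \<in> filt (Suc d)"
  proof -
    have kf: "k - v \<in> filt 0"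
      unfolding k_def y_def using closure_wop_filt cl z'(1) wop_filt fu
      by (intro filt.diff_mem filt.mult_mem_left filt.mult_mem_right) blast+
    have "(k - v) * (1 + n) * filt.uinv (Suc d) (1 + n) \<in> filt (Suc d)"
      using n1 by (intro filt.mult_mem_right[OF kn] filt.uinv_mem) simp
    moreover have "(k - v) * ((1 + n) * filt.uinv (Suc d) (1 + n) - 1) \<in> filt (Suc d)"
      using n1 by (intro filt.mult_mem_left[OF kf] filt.uinv_right) simp
    ultimately have "(k - v) * (1 + n) * filt.uinv (Suc d) (1 + n)
      - (k - v) * ((1 + n) * filt.uinv (Suc d) (1 + n) - 1) \<in> filt (Suc d)" by (rule filt.diff_mem)
    moreover have "(k - v) * (1 + n) * filt.uinv (Suc d) (1 + n)
      - (k - v) * ((1 + n) * filt.uinv (Suc d) (1 + n) - 1) = k - v"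
      by (simp only: right_diff_distrib mult.assoc mult_1_right) simp
    ultimately show ?thesis by simp
  qed
  ultimately show ?thesis using that by blast
qed

text \<open>Evaluation at the empty word is continuous in the operator and sends
  \<open>wop w\<close> to \<phi> w. There v yields 0, hence so does k, and values of \<phi> at
  padded admissible words come arbitrarily close.\<close>

theorem word_recurrence:
  assumes d: "d \<ge> 1" and \<phi>: "\<phi> \<in> wpoly (Suc d)" and "\<And>N. \<phi> (replicate N False) = 0" and "\<delta> > 0"
  obtains N w M where "w \<in> gwords d" "dist (\<phi> (replicate N False @ w @ replicate M False)) 0 < \<delta>"
proof -
  obtain k v where v: "v \<in> closure (wop ` {replicate N False |N. True})"
    and k: "k \<in> closure (wop ` {replicate N False @ w @ replicate M False |N w M. w \<in> gwords d})"
      (is "_ \<in> closure (wop ` ?K)")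
    and kv: "k - v \<in> filt (Suc d)"
    by (rule unipotent_limit[OF d])
  have ev: "continuous_on UNIV (\<lambda>T. ap T \<phi> [])"
    by (rule continuous_on_ap[OF continuous_on_id])
  let ?ev = "\<lambda>T. ap T \<phi> []"
  have "closed (?ev -` {0})"
    using ev by (simp add: continuous_on_closed_vimage)
  moreover have "wop ` {replicate N False |N. True} \<subseteq> ?ev -` {0}"
    using assms(3) by auto
  ultimately have "closure (wop ` {replicate N False |N. True}) \<subseteq> ?ev -` {0}"
    by (intro closure_minimal)
  from subsetD[OF this v] have v0: "ap v \<phi> [] = 0" by simp
  have "ap (k - v) \<phi> \<in> wpoly (Suc d - Suc d)"
    using kv[unfolded filt_def, simplified mem_Collect_eq, THEN spec, THEN bspec, OF \<phi>] .
  then have "ap (k - v) \<phi> [] = 0" by simp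
  then have 0: "ap k \<phi> [] = 0" using v0 by simp
  have "?ev ` closure (wop ` ?K) \<subseteq> closure (?ev ` wop ` ?K)"
    by (intro image_closure_subset continuous_on_subset[OF ev] closure_subset closed_closure subset_UNIV)
  from subsetD[OF this imageI[OF k]] have "0 \<in> closure (?ev ` wop ` ?K)" unfolding 0 .
  then have "\<exists>c\<in>?ev ` wop ` ?K. dist c 0 < \<delta>"
    using \<open>\<delta> > 0\<close> unfolding closure_approachable by (elim allE impE)
  then obtain N w M where w: "w \<in> gwords d"
    and "dist (?ev (wop (replicate N False @ w @ replicate M False))) 0 < \<delta>" by blast
  then show ?thesis using that[OF w] by simp
qed

section \<open>Polynomial phases as polynomial functions on words, and the passage from words to
  sets\<close>

lemma degree_pcompose_shift_diff:
  fixes q :: "real poly" and a b :: real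
  assumes "q = 0 \<or> degree q < Suc j"
  defines "r \<equiv> pcompose q [:a, 1:] - pcompose q [:b, 1:]"
  shows "r = 0 \<or> degree r < j"
proof -
  have q: "degree q \<le> j" using assms(1) by auto
  then have deg: "degree (pcompose q [:c, 1:]) \<le> j" for c by (simp add: degree_pcompose)
  have "coeff (pcompose q [:c, 1:]) j = (if degree q = j then lead_coeff q else 0)" for c
  proof (cases "degree q = j")
    case True
    then show ?thesis using lead_coeff_comp[of "[:c, 1:]" q] by (simp add: degree_pcompose)
  next
    case False
    then show ?thesis using q by (simp add: coeff_eq_0 degree_pcompose)
  qed
  then have "coeff r j = 0" by (simp add: r_def)
  moreover have "degree r \<le> j" unfolding r_def by (intro degree_diff_le deg)
  ultimately show ?thesis using eq_zero_or_degree_less by blast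
qed

text \<open>Letters are counted from 0 and the sequence from 1, hence
  \<open>n (Suc i)\<close>.\<close>

definition wsum :: "(nat \<Rightarrow> nat) \<Rightarrow> bool list \<Rightarrow> real" where
  "wsum n w = (\<Sum>i\<in>{i. i < length w \<and> w ! i}. real (n (Suc i)))"

lemma wsum_append: "wsum n (w @ w') = wsum n w + wsum (\<lambda>i. n (length w + i)) w'"
proof -
  have "{i. i < length (w @ w') \<and> (w @ w') ! i} =
    {i. i < length w \<and> w ! i} \<union> (\<lambda>i. length w + i) ` {i. i < length w' \<and> w' ! i}" (is "?S = ?A \<union> ?B")
  proof (intro set_eqI iffI)
    fix i assume i: "i \<in> ?S"
    show "i \<in> ?A \<union> ?B"
    proof (cases "i < length w")
      case False
      then have "i = length w + (i - length w)" "i - length w \<in> {i. i < length w' \<and> w' ! i}"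
        using i by (auto simp: nth_append)
      then show ?thesis by blast
    qed (use i in \<open>auto simp: nth_append\<close>)
  qed (auto simp: nth_append)
  moreover have "?A \<inter> ?B = {}" by auto
  moreover have "sum (\<lambda>i. real (n (Suc i))) ?B = wsum (\<lambda>i. n (length w + i)) w'"
    unfolding wsum_def by (subst sum.reindex) (auto simp: inj_on_def)
  ultimately show ?thesis
    by (simp add: wsum_def sum.union_disjoint)
qed

text \<open>The polynomial may depend on the length of the word because the summands contributed by
  a suffix depend on where it starts. Suffixes of equal length meet the same polynomial, so the
  leading terms cancel and the degree drops.\<close>

lemma poly_wpoly:
  assumes "\<And>m. q m = 0 \<or> degree (q m) < j"
    and "\<And>w. \<phi> w = circle_exp (poly (q (length w)) (wsum n w))"
  shows "\<phi> \<in> wpoly j"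
  using assms
proof (induction j arbitrary: q \<phi>)
  case 0
  then have "\<phi> w = 0 w" for w by (simp add: circle_exp_eq_0_iff)
  then have "\<phi> = 0" by (rule ext)
  then show ?case by (simp only: wpoly.simps singleton_iff)
next
  case (Suc j)
  have "ap (wop y - wop y') \<phi> \<in> wpoly j" if len: "length y = length y'" for y y'
  proof (rule Suc.IH)
    define c where "c z m = wsum (\<lambda>i. n (m + i)) z" for z m
    define r where "r m = pcompose (q (m + length y)) [:c y m, 1:] - pcompose (q (m + length y)) [:c y' m, 1:]" for m
    show "r m = 0 \<or> degree (r m) < j" for m
      unfolding r_def by (rule degree_pcompose_shift_diff) (rule Suc.prems)
    show "ap (wop y - wop y') \<phi> w = circle_exp (poly (r (length w)) (wsum n w))" for w
      using len by (simp add: Suc.prems(2) wsum_append r_def poly_pcompose c_def circle_exp_diff add.commute)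
  qed
  then show ?case by simp
qed

lemma gwords_S_fam:
  fixes N M :: nat
  assumes d: "d \<ge> 1" and w: "w \<in> gwords d"
  defines "W \<equiv> replicate N False @ w @ replicate M False"
  shows "Suc ` {i. i < length W \<and> W ! i} \<in> S_fam d"
proof -
  let ?P = "{i. i < length w \<and> w ! i}"
  have w': "w \<noteq> []" "hd w" "last w" "nogap d w" using w by (auto simp: gwords_def)
  have P: "Suc ` {i. i < length W \<and> W ! i} = (\<lambda>i. Suc (N + i)) ` ?P" (is "?\<alpha> = _")
  proof (intro set_eqI iffI)
    fix k assume "k \<in> ?\<alpha>"
    then obtain i where i: "k = Suc i" "i < length W" "W ! i" by auto
    then have "N \<le> i" "i - N < length w" "w ! (i - N)"
      by (auto simp: W_def nth_append split: if_splits)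
    then show "k \<in> (\<lambda>i. Suc (N + i)) ` ?P" using i(1) by (intro image_eqI[of _ _ "i - N"]) auto
  next
    fix k assume "k \<in> (\<lambda>i. Suc (N + i)) ` ?P"
    then show "k \<in> ?\<alpha>" by (auto simp: W_def nth_append)
  qed
  let ?l = "length w - 1"
  have l: "?l \<in> ?P" using w' by (simp add: last_conv_nth)
  have "finite ?P" by simp
  have max: "Max ?\<alpha> = Suc (N + ?l)"
    unfolding P
  proof (rule Max_eqI)
    show "Suc (N + ?l) \<in> (\<lambda>i. Suc (N + i)) ` ?P" using l by (rule imageI)
  qed auto
  \<comment> \<open>The d positions after i contain a taken one unless they run past the end of w;
    in that case the last letter, which is taken, is at distance at most d.\<close>
  have gap: "i = ?l \<or> (\<exists>j\<in>?P. i < j \<and> j \<le> i + d)" if i: "i \<in> ?P" for i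
  proof (cases "Suc i + d \<le> length w")
    case True
    then obtain j where "j < d" "w ! (Suc i + j)" using w'(4) unfolding nogap_def by blast
    then show ?thesis using True by (intro disjI2 bexI[of _ "Suc i + j"]) auto
  next
    case False
    have "i = ?l \<or> i < ?l" using i by auto
    then show ?thesis using l False by (auto intro!: bexI[of _ ?l])
  qed
  show ?thesis
    unfolding S_fam_def mem_Collect_eq
  proof (intro conjI ballI)
    show "finite ?\<alpha>" "?\<alpha> \<subseteq> {1..}" by auto
    show "?\<alpha> \<noteq> {}" unfolding P using l by blast
    fix k assume "k \<in> ?\<alpha>"
    then obtain i where i: "i \<in> ?P" "k = Suc (N + i)" unfolding P by blast
    from gap[OF i(1)] show "k = Max ?\<alpha> \<or> (\<exists>j\<in>?\<alpha>. k < j \<and> j \<le> k + d)"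
    proof
      assume "\<exists>j\<in>?P. i < j \<and> j \<le> i + d"
      then obtain j where "j \<in> ?P" "i < j" "j \<le> i + d" by blast
      then show ?thesis unfolding P using i(2) by (intro disjI2 bexI[of _ "Suc (N + j)"]) auto
    qed (simp only: max i(2) simp_thms)
  qed
qed

theorem theoremA:
  fixes p :: "real poly" and n :: "nat \<Rightarrow> nat" and \<epsilon> :: real
  assumes "degree p \<ge> 1"
    and "poly p 0 = 0"
    and "\<And>i. i \<ge> 1 \<Longrightarrow> n i > 0"
    and "\<epsilon> > 0"
  shows "\<exists>\<alpha>\<in>S_fam (degree p).
           dist_to_int (poly p (real (\<Sum>i\<in>\<alpha>. n i))) \<le> \<epsilon>"
proof -
  obtain \<delta> where \<delta>: "\<delta> > 0" "\<And>t. dist (circle_exp t) 0 < \<delta> \<Longrightarrow> dist_to_int t \<le> \<epsilon>"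
    using dist_to_int_small[OF assms(4)] by blast
  define \<phi> where "\<phi> w = circle_exp (poly p (wsum n w))" for w
  have "\<phi> \<in> wpoly (Suc (degree p))"
    by (rule poly_wpoly[of "\<lambda>_. p"]) (simp_all add: \<phi>_def)
  moreover have "\<phi> (replicate N False) = 0" for N
  proof -
    have "{i. i < length (replicate N False) \<and> replicate N False ! i} = {}" by auto
    then have "wsum n (replicate N False) = 0" unfolding wsum_def by (simp only: sum.empty)
    then show ?thesis by (simp add: \<phi>_def assms(2) circle_exp_eq_0_iff)
  qed
  ultimately obtain N w M where w: "w \<in> gwords (degree p)"
    "dist (\<phi> (replicate N False @ w @ replicate M False)) 0 < \<delta>"
    using word_recurrence[OF assms(1) _ _ \<delta>(1)] by blast
  define W where "W = replicate N False @ w @ replicate M False"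
  let ?\<alpha> = "Suc ` {i. i < length W \<and> W ! i}"
  have "wsum n W = real (\<Sum>i\<in>?\<alpha>. n i)"
    unfolding wsum_def by (simp add: sum.reindex)
  then have "dist_to_int (poly p (real (\<Sum>i\<in>?\<alpha>. n i))) \<le> \<epsilon>"
    using \<delta>(2) w(2) by (simp add: \<phi>_def W_def)
  then show ?thesis
    using gwords_S_fam[OF assms(1) w(1)] unfolding W_def by blast
qed

end
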